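(* For every $q>2$ there is an (explicit) constant $\delta(q)>0$ depending only on $q$ with the following property. Let $L_1,L_2>0$ and let $\Gamma_1:S_{L_1}\to\mathbb{R}^3$, $\Gamma_2:S_{L_2}\to\mathbb{R}^3$ be injective arclength parametrizations of two closed rectifiable curves with $\mathcal{E}_q(\Gamma_1)<\infty$ and $\mathcal{E}_q(\Gamma_2)<\infty$. If the Hausdorff distance of the images $\Gamma_1(S_{L_1})$ and $\Gamma_2(S_{L_2})$ is less than $$\delta(q)\,\max\{\mathcal{E}_q(\Gamma_1),\mathcal{E}_q(\Gamma_2)\}^{-\frac{1}{q-2}},$$ then the two curves are ambient isotopic.
   Context: $S_L\cong\mathbb{R}/(L\mathbb{Z})$ is the circle of perimeter $L$. An arclength parametrization of a closed curve of length $L$ is a Lipschitz map $\Gamma:S_L\to\mathbb{R}^n$ with $|\Gamma'|=1$ a.e. For $s\in S_L$ and almost every $t\in S_L$ (those where $\Gamma'(t)$ exists with $|\Gamma'(t)|=1$) let $\ell(t)=\{\Gamma(t)+\mu\Gamma'(t):\mu\in\mathbb{R}\}$ be the tangent line, and define the tangent-point radius $$r(\Gamma(t),\Gamma(s))=\frac{|\Gamma(t)-\Gamma(s)|^2}{2\operatorname{dist}(\ell(t),\Gamma(s))}\in[0,\infty],$$ where $r$ is set to be $0$ if $\Gamma(t)=\Gamma(s)$, and $r=\infty$ (i.e. $1/r=0$) if $\Gamma(s)-\Gamma(t)\neq0$ is parallel to $\Gamma'(t)$. The tangent-point energy is $$\mathcal{E}_q(\Gamma)=\int_0^L\int_0^L\frac{ds\,dt}{r(\Gamma(t),\Gamma(s))^q}.$$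 *)

theory Defs
  imports "HOL-Analysis.Analysis"
begin

text \<open>
  A map on the circle of perimeter \<open>L\<close> is represented by its \<open>L\<close>-periodic lift to the real line;
  it is injective iff the lift is injective on \<open>{0..<L}\<close>, and its image is the range of the lift.
\<close>

definition arclength_param :: "real \<Rightarrow> (real \<Rightarrow> 'a::euclidean_space) \<Rightarrow> bool" where
  "arclength_param L \<Gamma> \<longleftrightarrow>
     (\<forall>t. \<Gamma> (t + L) = \<Gamma> t) \<and>
     (\<exists>C. C-lipschitz_on UNIV \<Gamma>) \<and>
     (AE t in lborel. \<Gamma> differentiable (at t) \<and> norm (vector_derivative \<Gamma> (at t)) = 1)"

definition injective_arclength_param :: "real \<Rightarrow> (real \<Rightarrow> 'a::euclidean_space) \<Rightarrow> bool" where
  "injective_arclength_param L \<Gamma> \<longleftrightarrow> arclength_param L \<Gamma> \<and> inj_on \<Gamma> {0..<L}"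

definition tangent_line :: "(real \<Rightarrow> 'a::euclidean_space) \<Rightarrow> real \<Rightarrow> 'a set" where
  "tangent_line \<Gamma> t = {\<Gamma> t + \<mu> *\<^sub>R vector_derivative \<Gamma> (at t) | \<mu>. True}"

text \<open>
  The denominator vanishes exactly when \<open>\<Gamma> s\<close> lies on the tangent line at \<open>t\<close>; division by zero
  in \<^typ>\<open>ennreal\<close> then gives \<open>\<infinity>\<close> as long as \<open>\<Gamma> s \<noteq> \<Gamma> t\<close>.
\<close>

definition tangent_point_radius :: "(real \<Rightarrow> 'a::euclidean_space) \<Rightarrow> real \<Rightarrow> real \<Rightarrow> ennreal" where
  "tangent_point_radius \<Gamma> t s =
     (if \<Gamma> t = \<Gamma> s then 0
      else ennreal ((norm (\<Gamma> t - \<Gamma> s))\<^sup>2) / ennreal (2 * infdist (\<Gamma> s) (tangent_line \<Gamma> t)))"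

text \<open>Real powers on \<open>[0,\<infinity>]\<close>; only used with a positive exponent.\<close>

definition ennreal_powr :: "ennreal \<Rightarrow> real \<Rightarrow> ennreal" where
  "ennreal_powr x p = (if x = \<infinity> then \<infinity> else ennreal (enn2real x powr p))"

text \<open>The outer integration is over those \<open>t\<close> at which the unit tangent exists (almost every \<open>t\<close>).\<close>

definition tangent_point_energy :: "real \<Rightarrow> real \<Rightarrow> (real \<Rightarrow> 'a::euclidean_space) \<Rightarrow> ennreal" where
  "tangent_point_energy q L \<Gamma> =
     (\<integral>\<^sup>+ t \<in> {t \<in> {0..L}. \<Gamma> differentiable (at t) \<and> norm (vector_derivative \<Gamma> (at t)) = 1}.
       (\<integral>\<^sup>+ s \<in> {0..L}. ennreal_powr (inverse (tangent_point_radius \<Gamma> t s)) q \<partial>lborel) \<partial>lborel)"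

text \<open>The usual Hausdorff distance for nonempty bounded sets.\<close>

definition hausdorff_distance :: "'a::metric_space set \<Rightarrow> 'a set \<Rightarrow> real" where
  "hausdorff_distance A B = max (SUP x\<in>A. infdist x B) (SUP y\<in>B. infdist y A)"

definition ambient_isotopic :: "'a::euclidean_space set \<Rightarrow> 'a set \<Rightarrow> bool" where
  "ambient_isotopic A B \<longleftrightarrow>
     (\<exists>H :: real \<Rightarrow> 'a \<Rightarrow> 'a.
        continuous_on ({0..1} \<times> UNIV) (\<lambda>(\<tau>, x). H \<tau> x) \<and>
        (\<forall>\<tau>\<in>{0..1}. \<exists>G. homeomorphism UNIV UNIV (H \<tau>) G) \<and>
        (\<forall>x. H 0 x = x) \<and>
        H 1 ` A = B)"

end

(*
  The tangent-point energy controls flatness. If |y - x| = d, |z - x| <= 2 d and z lies farther than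
  15 e d from the line through x and y, then no line close to x is close to both y and z. So each
  tangent line along an arc of length e d at x stays away from an arc of that length at y or from one
  at z, and the energy is at least a constant times e^(q+2) d^(2-q). As q > 2, this forces e to decay
  geometrically along dyadic scales d below a constant times E^(-1/(q-2)); hence all chords of the
  curve inside a ball of that size are nearly parallel.

  Let tau(s) = (Gamma_1 (s + r) - Gamma_1 (s - r)) / (2 r). For two curves with this property at
  scale r whose distance is small against r, the plane through Gamma_1 s orthogonal to tau(s) meets
  Gamma_2 near Gamma_1 s in exactly one point, and every point of Gamma_2 arises in this way. The
  displacement Gamma_1 -> Gamma_2 so defined has a small Lipschitz constant with respect to the
  distance in space; it extends to a contraction F of the whole space, and x + lambda F(x) for
  0 <= lambda <= 1 is the required isotopy.
*)

theory Submission
  imports Defs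
begin

section \<open>Isotopies from small Lipschitz displacements\<close>

text \<open>The displacement has to be Lipschitz, so the direction it is orthogonal to has to vary
  in a Lipschitz way too. Tangents would not do: they exist only almost everywhere, and flatness
  that decays like a power of the scale gives Hoelder control of them at best. A secant over a
  parameter interval of length 2 r varies with Lipschitz constant 1 / r, whatever the curve does at
  smaller scales; as the displacement is tiny against r, the turning of the planes adds only a small
  multiple of the distance. Extending to all of space needs the Lipschitz bound with respect to
  distance in space, so two strands of one curve must not come close to each other. Straightness is
  therefore required of the whole image inside a ball: this forces every nearby point of the curve
  onto the same arc. The numerical constants only have to lead to 3 * 1/4 < 1 at the end, where 1/4
  is the Lipschitz constant of the displacement and 3 is the price of extending it
  coordinatewise.\<close>

lemma mcshane_extension:
  fixes f :: "'a::metric_space \<Rightarrow> real"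
  assumes "C-lipschitz_on A f"
  shows "\<exists>g. C-lipschitz_on UNIV g \<and> (\<forall>x\<in>A. g x = f x)"
proof (cases "A = {}")
  case True
  then show ?thesis
    using lipschitz_on_nonneg[OF assms] by (auto intro!: exI[of _ "\<lambda>_. 0"] lipschitz_onI)
next
  case False
  have C: "C \<ge> 0" using lipschitz_on_nonneg[OF assms] .
  have lip: "f x \<le> f y + C * dist x y" if "x \<in> A" "y \<in> A" for x y
    using lipschitz_onD[OF assms that] by (simp add: dist_real_def)
  define g where "g x = (INF a\<in>A. f a + C * dist x a)" for x
  have tri: "C * dist x a \<le> C * dist x y + C * dist y a" for x y a
    using mult_left_mono[OF dist_triangle[of x a y] C] by (simp add: algebra_simps)
  have bdd: "bdd_below ((\<lambda>a. f a + C * dist x a) ` A)" for x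
  proof -
    obtain a0 where a0: "a0 \<in> A" using False by auto
    have "f a0 - C * dist x a0 \<le> f a + C * dist x a" if "a \<in> A" for a
      using lip[OF a0 that] tri[of a0 a x] by (simp add: dist_commute)
    then show ?thesis by (auto intro!: bdd_belowI2)
  qed
  have "g x \<le> g y + C * dist x y" for x y
  proof -
    have "g x - C * dist x y \<le> g y"
      unfolding g_def[of y]
    proof (rule cINF_greatest[OF False])
      fix a assume a: "a \<in> A"
      have "g x \<le> f a + C * dist x a" unfolding g_def by (rule cINF_lower[OF bdd a])
      then show "g x - C * dist x y \<le> f a + C * dist y a" using tri[of x a y] by linarith
    qed
    then show ?thesis by simp
  qed
  from this this[of y x for x y] have "\<bar>g x - g y\<bar> \<le> C * dist x y" for x y
    by (smt (verit) dist_commute)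
  then have "C-lipschitz_on UNIV g" by (intro lipschitz_onI C) (simp add: dist_real_def)
  moreover have "g x = f x" if "x \<in> A" for x
  proof (rule antisym)
    show "g x \<le> f x" unfolding g_def using cINF_lower[OF bdd that, of x] by simp
    show "f x \<le> g x" unfolding g_def using lip[OF that] by (intro cINF_greatest[OF False])
  qed
  ultimately show ?thesis by blast
qed

text \<open>Each coordinate is extended separately with constant \<open>C\<close>; bounding the norm
  by the sum of the coordinates then costs the factor \<open>DIM('b)\<close>. In dimension 3 this
  loss asks for a displacement with constant below 1/3.\<close>

lemma lipschitz_extension_euclidean:
  fixes f :: "'a::metric_space \<Rightarrow> 'b::euclidean_space"
  assumes "C-lipschitz_on A f"
  shows "\<exists>g. (real DIM('b) * C)-lipschitz_on UNIV g \<and> (\<forall>x\<in>A. g x = f x)"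
proof -
  have C: "C \<ge> 0" using lipschitz_on_nonneg[OF assms] .
  have "\<exists>g. C-lipschitz_on UNIV g \<and> (\<forall>x\<in>A. g x = f x \<bullet> i)" if "i \<in> Basis" for i
  proof (rule mcshane_extension, rule lipschitz_onI[OF _ C])
    fix x y assume "x \<in> A" "y \<in> A"
    have "dist (f x \<bullet> i) (f y \<bullet> i) \<le> dist (f x) (f y)"
      using Basis_le_norm[OF that, of "f x - f y"] by (simp add: dist_norm inner_diff_left)
    then show "dist (f x \<bullet> i) (f y \<bullet> i) \<le> C * dist x y"
      using lipschitz_onD[OF assms \<open>x \<in> A\<close> \<open>y \<in> A\<close>] by linarith
  qed
  then obtain g where g: "\<And>i. i \<in> Basis \<Longrightarrow> C-lipschitz_on UNIV (g i)"
    "\<And>i x. i \<in> Basis \<Longrightarrow> x \<in> A \<Longrightarrow> g i x = f x \<bullet> i" by metis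
  define h where "h x = (\<Sum>i\<in>Basis. g i x *\<^sub>R i)" for x
  have hi: "h x \<bullet> i = g i x" if "i \<in> Basis" for x i
    using that by (simp add: h_def)
  have "dist (h x) (h y) \<le> DIM('b) * C * dist x y" for x y
  proof -
    have "dist (h x) (h y) \<le> (\<Sum>i\<in>Basis. \<bar>(h x - h y) \<bullet> i\<bar>)"
      unfolding dist_norm by (rule norm_le_l1)
    also have "\<dots> \<le> (\<Sum>i\<in>(Basis::'b set). C * dist x y)"
      using lipschitz_onD[OF g(1)] by (intro sum_mono) (auto simp: inner_diff_left hi dist_real_def)
    finally show ?thesis by simp
  qed
  then have "(real DIM('b) * C)-lipschitz_on UNIV h" using C by (intro lipschitz_onI) auto
  moreover have "h x = f x" if "x \<in> A" for x
    by (rule euclidean_eqI) (simp add: hi g that)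
  ultimately show ?thesis by blast
qed

text \<open>Solving \<open>x + F x = y\<close> for \<open>x\<close> is a fixed point problem for the
  contraction \<open>\<lambda>x. y - F x\<close>, so Banach's theorem gives the inverse. It is
  continuous because \<open>F\<close> can cancel at most the fraction \<open>c\<close> of a
  difference.\<close>

lemma homeomorphism_id_plus_contraction:
  fixes F :: "'a::banach \<Rightarrow> 'a"
  assumes "c-lipschitz_on UNIV F" "c < 1"
  shows "\<exists>G. homeomorphism UNIV UNIV (\<lambda>x. x + F x) G"
proof -
  have c: "c \<ge> 0" using lipschitz_on_nonneg[OF assms(1)] .
  have L: "norm (F x - F y) \<le> c * norm (x - y)" for x y
    using lipschitz_onD[OF assms(1), of x y] by (simp add: dist_norm)
  have ex: "\<exists>!x. y - F x = x" for y
  proof -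
    have "dist (y - F x) (y - F x') \<le> c * dist x x'" for x x'
      using L[of x' x] by (simp add: dist_norm norm_minus_commute)
    then show ?thesis
      using Banach_fix[OF complete_UNIV _ c assms(2), of "\<lambda>x. y - F x"] by auto
  qed
  define G where "G y = (THE x. y - F x = x)" for y
  have G: "y - F (G y) = G y" for y
    unfolding G_def using theI'[OF ex[of y]] by simp
  then have FG: "G y + F (G y) = y" for y by (metis diff_add_cancel)
  have GF: "G (x + F x) = x" for x
    using ex[of "x + F x"] G[of "x + F x"] by (metis add_diff_cancel_right')
  have "(1 - c) * norm (x - y) \<le> norm (x + F x - (y + F y))" for x y
  proof -
    have "norm (x - y) \<le> norm (x + F x - (y + F y)) + norm (F x - F y)"
      using norm_triangle_ineq4[of "x + F x - (y + F y)" "F x - F y"] by (simp add: algebra_simps)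
    then show ?thesis using L[of x y] by (simp add: algebra_simps)
  qed
  from this[of "G x" "G y" for x y] have "dist (G x) (G y) \<le> 1 / (1 - c) * dist x y" for x y
    using assms(2) by (simp add: FG dist_norm field_simps)
  then have "(1 / (1 - c))-lipschitz_on UNIV G"
    using assms(2) by (intro lipschitz_onI) auto
  then have "continuous_on UNIV G" by (rule lipschitz_on_continuous_on)
  moreover have "continuous_on UNIV F" using assms(1) by (rule lipschitz_on_continuous_on)
  ultimately have "homeomorphism UNIV UNIV (\<lambda>x. x + F x) G"
    by (auto simp: homeomorphism_def FG GF intro!: continuous_intros)
      (metis FG UNIV_I image_eqI, metis GF UNIV_I image_eqI)
  then show ?thesis by blast
qed

lemma ambient_isotopic_small_lipschitz:
  fixes f :: "'a::euclidean_space \<Rightarrow> 'a"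
  assumes "C-lipschitz_on A f" "real DIM('a) * C < 1"
  shows "ambient_isotopic A ((\<lambda>x. x + f x) ` A)"
proof -
  obtain F where F: "(real DIM('a) * C)-lipschitz_on UNIV F" and Ff: "\<And>x. x \<in> A \<Longrightarrow> F x = f x"
    using lipschitz_extension_euclidean[OF assms(1)] by blast
  have cont: "continuous_on UNIV F" using F by (rule lipschitz_on_continuous_on)
  show ?thesis unfolding ambient_isotopic_def
  proof (intro exI[of _ "\<lambda>\<tau> x. x + \<tau> *\<^sub>R F x"] conjI ballI)
    show "continuous_on ({0..1} \<times> UNIV) (\<lambda>(\<tau>, x). x + \<tau> *\<^sub>R F x)"
      unfolding case_prod_unfold
      by (intro continuous_intros continuous_on_compose2[OF cont]) auto
    show "\<exists>G. homeomorphism UNIV UNIV (\<lambda>x. x + \<tau> *\<^sub>R F x) G" if "\<tau> \<in> {0..1}" for \<tau>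
    proof (rule homeomorphism_id_plus_contraction[OF _ assms(2)])
      show "(real DIM('a) * C)-lipschitz_on UNIV (\<lambda>x. \<tau> *\<^sub>R F x)"
      proof (rule lipschitz_onI)
        fix x y
        have "dist (\<tau> *\<^sub>R F x) (\<tau> *\<^sub>R F y) = \<tau> * dist (F x) (F y)"
          using that by (simp add: dist_norm flip: scaleR_diff_right)
        also have "\<dots> \<le> dist (F x) (F y)" using that by (simp add: mult_left_le_one_le)
        also have "\<dots> \<le> DIM('a) * C * dist x y" using lipschitz_onD[OF F] by simp
        finally show "dist (\<tau> *\<^sub>R F x) (\<tau> *\<^sub>R F y) \<le> DIM('a) * C * dist x y" .
      qed (use lipschitz_on_nonneg[OF F] in simp)
    qed
  qed (use Ff in auto)
qed

section \<open>Lipschitz maps and almost everywhere derivatives\<close>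

text \<open>
  Increments near the exceptional null set are controlled by the Lipschitz constant and charged to the
  measure of an open set of small measure that contains it.
\<close>

lemma lipschitz_AE_deriv_le:
  fixes g :: "real \<Rightarrow> real"
  assumes "a \<le> b" and lip: "C-lipschitz_on UNIV g"
    and ae: "AE t in lborel. a \<le> t \<longrightarrow> t \<le> b \<longrightarrow> (\<exists>D\<le>M. (g has_real_derivative D) (at t))"
  shows "g b - g a \<le> M * (b - a)"
proof -
  have C: "C \<ge> 0" using lipschitz_on_nonneg[OF lip] .
  obtain N where N: "N \<in> sets lborel" "emeasure lborel N = 0"
    "\<And>t. t \<notin> N \<Longrightarrow> a \<le> t \<Longrightarrow> t \<le> b \<Longrightarrow> \<exists>D\<le>M. (g has_real_derivative D) (at t)"
    using ae by (elim AE_E) (auto simp: subset_iff, blast+)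
  have key: "g b - g a \<le> (M + e) * (b - a) + (C + \<bar>M\<bar>) * e" if e: "e > 0" for e
  proof -
    obtain U where U: "open U" "N \<subseteq> U" "emeasure lborel (U - N) < ennreal e"
      using outer_regular_lborel[of N e] N(1) e by auto
    have Um: "U \<in> sets lborel" "N \<in> sets lborel" using U(1) N(1) by auto
    have Ue: "emeasure lborel U < ennreal e"
      using U(3) emeasure_Diff_null_set[of N lborel U] N borel_open[OF U(1)] by (simp add: null_sets_def)
    have fin: "U \<inter> S \<in> fmeasurable lborel" if "S \<in> sets lborel" for S
      using that emeasure_mono[of "U \<inter> S" U lborel] Ue Um
      by (intro fmeasurableI) (auto intro: order.strict_trans1 order.strict_trans)
    define m where "m u w = measure lborel (U \<inter> {u<..w})" for u w
    \<comment> \<open>\<open>P\<close> passes to unions of adjacent intervals, since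
      \<open>m\<close> is additive on half-open ones, so \<open>Bolzano\<close> reduces it to short
      intervals around one point. The \<open>\<bar>M\<bar>\<close> in the coefficient pays for a
      negative \<open>M\<close> on intervals inside \<open>U\<close>, where only the slope bound
      \<open>C\<close> is available.\<close>
    define P where "P u w \<longleftrightarrow> g w - g u \<le> (M + e) * (w - u) + (C + \<bar>M\<bar>) * m u w" for u w
    have "P a b"
    proof (rule Bolzano[OF \<open>a \<le> b\<close>])
      fix u v w assume *: "P u v" "P v w" "u \<le> v" "v \<le> w"
      have un: "U \<inter> {u<..w} = (U \<inter> {u<..v}) \<union> (U \<inter> {v<..w})"
        and diff: "U \<inter> {v<..w} - U \<inter> {u<..v} = U \<inter> {v<..w}" using * by auto
      have "m u w = m u v + m v w"
        unfolding m_def un using measure_Un2[OF fin fin, of "{u<..v}" "{v<..w}"] by (simp add: diff)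
      then show "P u w" using *(1,2) unfolding P_def by (simp add: algebra_simps)
    next
      fix x assume x: "a \<le> x" "x \<le> b"
      show "\<exists>d>0. \<forall>u w. u \<le> x \<and> x \<le> w \<and> w - u < d \<longrightarrow> P u w"
      proof (cases "x \<in> N")
        case True
        then obtain d where d: "d > 0" "ball x d \<subseteq> U" using U by (meson openE subsetD)
        have "P u w" if "u \<le> x" "x \<le> w" "w - u < d" for u w
        proof -
          have "{u<..w} \<subseteq> ball x d" using that by (auto simp: dist_real_def)
          then have "U \<inter> {u<..w} = {u<..w}" using d by auto
          then have m: "m u w = w - u" using that by (simp add: m_def)
          have "g w - g u \<le> C * (w - u)" using lipschitz_onD[OF lip, of w u] that by (auto simp: dist_real_def)
          moreover have "0 \<le> (M + \<bar>M\<bar> + e) * (w - u)" using that e by (intro mult_nonneg_nonneg) auto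
          ultimately show "P u w" unfolding P_def m by (simp add: algebra_simps)
        qed
        then show ?thesis using d(1) by blast
      next
        case False
        then obtain D where D: "D \<le> M" "(g has_real_derivative D) (at x)" using N(3) x by blast
        then have "(g has_derivative (*) D) (at x)" by (simp add: has_field_derivative_def)
        from this[unfolded has_derivative_at_alt] e obtain d where d: "d > 0"
          "\<And>y. \<bar>y - x\<bar> < d \<Longrightarrow> \<bar>g y - g x - D * (y - x)\<bar> \<le> e * \<bar>y - x\<bar>"
          by (auto simp: dist_real_def)
        have "P u w" if "u \<le> x" "x \<le> w" "w - u < d" for u w
        proof -
          have "\<bar>g w - g x - D * (w - x)\<bar> \<le> e * (w - x)" "\<bar>g u - g x - D * (u - x)\<bar> \<le> e * (x - u)"
            using d(2)[of w] d(2)[of u] that by auto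
          then have "g w - g u \<le> (D + e) * (w - u)" by (simp add: algebra_simps)
          also have "\<dots> \<le> (M + e) * (w - u)" using D that by (intro mult_right_mono) auto
          also have "\<dots> \<le> (M + e) * (w - u) + (C + \<bar>M\<bar>) * m u w" using C by (simp add: m_def)
          finally show ?thesis unfolding P_def .
        qed
        then show ?thesis using d(1) by blast
      qed
    qed
    moreover have "m a b \<le> e"
    proof -
      have "emeasure lborel (U \<inter> {a<..b}) \<le> ennreal e"
        using emeasure_mono[of "U \<inter> {a<..b}" U lborel] Ue Um by (auto simp: less_imp_le)
      then show ?thesis unfolding m_def measure_def using e by (simp add: enn2real_leI)
    qed
    then have "(C + \<bar>M\<bar>) * m a b \<le> (C + \<bar>M\<bar>) * e" using C by (intro mult_left_mono) auto
    ultimately show ?thesis unfolding P_def by linarith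
  qed
  show ?thesis
  proof (rule field_le_epsilon)
    fix e :: real assume e: "e > 0"
    define K where "K = (b - a) + C + \<bar>M\<bar> + 1"
    have K: "K > 0" unfolding K_def using C \<open>a \<le> b\<close> by auto
    have "(M + t) * (b - a) + (C + \<bar>M\<bar>) * t = M * (b - a) + t * (K - 1)" for t
      by (simp add: K_def algebra_simps)
    from this[of "e/K"] have "(M + e/K) * (b - a) + (C + \<bar>M\<bar>) * (e/K) = M * (b - a) + (e/K) * (K - 1)" .
    also have "\<dots> \<le> M * (b - a) + e" using K e by (simp add: field_simps)
    finally show "g b - g a \<le> M * (b - a) + e" using key[of "e/K"] K e by simp
  qed
qed

text \<open>Testing against a fixed vector reduces curves to the scalar case. It is applied with the
  direction of a chord, to bound its length, and with a negated axis, to bound progress along that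
  axis from below.\<close>

lemma lipschitz_AE_inner_deriv_le:
  fixes \<Gamma> :: "real \<Rightarrow> 'a::euclidean_space"
  assumes "a \<le> b" and lip: "C-lipschitz_on UNIV \<Gamma>"
    and ae: "AE t in lborel. a \<le> t \<longrightarrow> t \<le> b \<longrightarrow> (\<exists>D. (\<Gamma> has_vector_derivative D) (at t) \<and> D \<bullet> e \<le> M)"
  shows "(\<Gamma> b - \<Gamma> a) \<bullet> e \<le> M * (b - a)"
proof -
  have "dist (\<Gamma> x \<bullet> e) (\<Gamma> y \<bullet> e) \<le> C * norm e * dist x y" for x y
  proof -
    have "dist (\<Gamma> x \<bullet> e) (\<Gamma> y \<bullet> e) \<le> dist (\<Gamma> x) (\<Gamma> y) * norm e"
      unfolding dist_norm by (metis Cauchy_Schwarz_ineq2 inner_diff_left real_norm_def)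
    also have "\<dots> \<le> (C * dist x y) * norm e"
      using lipschitz_onD[OF lip] by (intro mult_right_mono) auto
    finally show ?thesis by (simp add: mult_ac)
  qed
  then have "(C * norm e)-lipschitz_on UNIV (\<lambda>t. \<Gamma> t \<bullet> e)"
    using lipschitz_on_nonneg[OF lip] by (intro lipschitz_onI) auto
  moreover have "AE t in lborel. a \<le> t \<longrightarrow> t \<le> b \<longrightarrow>
      (\<exists>D\<le>M. ((\<lambda>t. \<Gamma> t \<bullet> e) has_real_derivative D) (at t))"
    using ae
  proof (eventually_elim, intro impI)
    fix t assume "a \<le> t \<longrightarrow> t \<le> b \<longrightarrow> (\<exists>D. (\<Gamma> has_vector_derivative D) (at t) \<and> D \<bullet> e \<le> M)"
      and "a \<le> t" "t \<le> b"
    then obtain D where D: "(\<Gamma> has_vector_derivative D) (at t)" "D \<bullet> e \<le> M" by blast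
    from D(1) have "((\<lambda>t. \<Gamma> t \<bullet> e) has_vector_derivative D \<bullet> e) (at t)"
      by (rule bounded_linear.has_vector_derivative[OF bounded_linear_inner_left])
    then show "\<exists>D\<le>M. ((\<lambda>t. \<Gamma> t \<bullet> e) has_real_derivative D) (at t)"
      using D(2) by (auto simp: has_real_derivative_iff_has_vector_derivative)
  qed
  ultimately have "\<Gamma> b \<bullet> e - \<Gamma> a \<bullet> e \<le> M * (b - a)"
    by (rule lipschitz_AE_deriv_le[OF \<open>a \<le> b\<close>])
  then show ?thesis by (simp add: inner_diff_left)
qed

section \<open>Basic facts on arclength parametrizations\<close>

lemma arclength_param_AE:
  assumes "arclength_param L \<Gamma>"
  shows "AE t in lborel. \<exists>D. (\<Gamma> has_vector_derivative D) (at t) \<and> norm D = 1"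
proof -
  have "AE t in lborel. \<Gamma> differentiable (at t) \<and> norm (vector_derivative \<Gamma> (at t)) = 1"
    using assms by (simp add: arclength_param_def)
  then show ?thesis by eventually_elim (auto simp: vector_derivative_works)
qed

text \<open>The definition grants only some Lipschitz constant. Unit speed almost everywhere
  improves it to 1: test a chord against its own direction.\<close>

lemma arclength_param_lipschitz:
  fixes \<Gamma> :: "real \<Rightarrow> 'a::euclidean_space"
  assumes "arclength_param L \<Gamma>"
  shows "1-lipschitz_on UNIV \<Gamma>"
proof -
  obtain C where C: "C-lipschitz_on UNIV \<Gamma>" using assms by (auto simp: arclength_param_def)
  have le: "norm (\<Gamma> b - \<Gamma> a) \<le> b - a" if "a \<le> b" for a b
  proof -
    define e where "e = sgn (\<Gamma> b - \<Gamma> a)"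
    have e: "norm e \<le> 1" by (simp add: e_def norm_sgn)
    have "AE t in lborel. a \<le> t \<longrightarrow> t \<le> b \<longrightarrow> (\<exists>D. (\<Gamma> has_vector_derivative D) (at t) \<and> D \<bullet> e \<le> 1)"
      using arclength_param_AE[OF assms]
    proof eventually_elim
      case (elim t)
      then obtain D where D: "(\<Gamma> has_vector_derivative D) (at t)" "norm D = 1" by blast
      have "D \<bullet> e \<le> 1" using norm_cauchy_schwarz[of D e] D(2) e by simp
      then show ?case using D by blast
    qed
    from lipschitz_AE_inner_deriv_le[OF that C this] have "(\<Gamma> b - \<Gamma> a) \<bullet> e \<le> b - a" by simp
    moreover have "(\<Gamma> b - \<Gamma> a) \<bullet> e = norm (\<Gamma> b - \<Gamma> a)"
      by (cases "\<Gamma> b = \<Gamma> a") (auto simp: e_def sgn_div_norm power2_norm_eq_inner[symmetric] power2_eq_square)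
    ultimately show ?thesis by simp
  qed
  show ?thesis
  proof (rule lipschitz_onI)
    fix x y show "dist (\<Gamma> x) (\<Gamma> y) \<le> 1 * dist x y"
      using le[of x y] le[of y x] by (cases "x \<le> y") (auto simp: dist_norm norm_minus_commute)
  qed simp
qed

lemma arclength_param_norm_le:
  fixes \<Gamma> :: "real \<Rightarrow> 'a::euclidean_space"
  assumes "arclength_param L \<Gamma>"
  shows "norm (\<Gamma> s - \<Gamma> t) \<le> \<bar>s - t\<bar>"
  using lipschitz_onD[OF arclength_param_lipschitz[OF assms], of s t] by (simp add: dist_norm)

lemma arclength_param_periodic:
  assumes "arclength_param L \<Gamma>"
  shows "\<Gamma> (t + of_int k * L) = \<Gamma> t"
proof -
  have per: "\<Gamma> (t + L) = \<Gamma> t" for t using assms by (simp add: arclength_param_def)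
  show ?thesis
  proof (induction k rule: int_induct[of _ 0])
    case (step1 i)
    then show ?case using per[of "t + of_int i * L"] by (simp add: algebra_simps)
  next
    case (step2 i)
    then show ?case using per[of "t + of_int (i - 1) * L"] by (simp add: algebra_simps)
  qed simp
qed

lemma arclength_param_reduce:
  assumes "arclength_param L \<Gamma>" "L > 0"
  obtains k :: int where "t + of_int k * L \<in> {a..<a+L}" "\<Gamma> (t + of_int k * L) = \<Gamma> t"
proof
  let ?k = "- \<lfloor>(t - a) / L\<rfloor>"
  show "t + of_int ?k * L \<in> {a..<a+L}"
    using floor_divide_lower[OF assms(2), of "t - a"] floor_divide_upper[OF assms(2), of "t - a"]
    by (auto simp: algebra_simps)
  show "\<Gamma> (t + of_int ?k * L) = \<Gamma> t" by (rule arclength_param_periodic[OF assms(1)])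
qed

section \<open>Lower bounds for the tangent-point energy\<close>

text \<open>In the application \<open>p\<close> is a curve point near \<open>x\<close> and
  \<open>u\<close> its unit tangent. Moving the base point of the line from \<open>p\<close> to
  \<open>x\<close> turns the errors \<open>2 * e * d\<close> into \<open>3 * e * d\<close>; the
  result collects one such error from \<open>z\<close> and at most four from \<open>y\<close>,
  whence 15.\<close>

lemma three_points_near_line:
  fixes p u x y z :: "'a::real_normed_vector"
  assumes u: "norm u = 1" and d: "d = norm (y - x)" "d > 0" and z: "norm (z - x) \<le> 2 * d"
    and e: "0 < e" "e \<le> 1/20"
    and "norm (p - x) \<le> e * d" "norm (y - (p + \<beta> *\<^sub>R u)) \<le> 2 * e * d" "norm (z - (p + \<gamma> *\<^sub>R u)) \<le> 2 * e * d"
  shows "\<exists>\<mu>. norm (z - x - \<mu> *\<^sub>R (y - x)) \<le> 15 * e * d"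
proof -
  define E where "E = 3 * e * d"
  have E: "0 < E" "E \<le> 3/20 * d" using e d by (auto simp: E_def)
  define y' z' where "y' = y - x - \<beta> *\<^sub>R u" "z' = z - x - \<gamma> *\<^sub>R u"
  have y': "norm y' \<le> E"
    using norm_triangle_ineq[of "y - (p + \<beta> *\<^sub>R u)" "p - x"] assms
    by (simp add: y'_z'_def E_def algebra_simps)
  have z': "norm z' \<le> E"
    using norm_triangle_ineq[of "z - (p + \<gamma> *\<^sub>R u)" "p - x"] assms
    by (simp add: y'_z'_def E_def algebra_simps)
  have yb: "y - x = \<beta> *\<^sub>R u + y'" and zc: "z - x = \<gamma> *\<^sub>R u + z'" by (auto simp: y'_z'_def)
  have "d \<le> \<bar>\<beta>\<bar> + E" using norm_triangle_ineq[of "\<beta> *\<^sub>R u" y'] y' u d(1) by (simp add: yb)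
  then have \<beta>: "17/20 * d \<le> \<bar>\<beta>\<bar>" using E by simp
  have "\<bar>\<gamma>\<bar> \<le> norm (z - x) + E"
    using norm_triangle_ineq4[of "z - x" z'] z' u by (simp add: zc)
  then have \<gamma>: "\<bar>\<gamma>\<bar> \<le> 43/20 * d" using E z by simp
  \<comment> \<open>This ratio cancels the multiples of \<open>u\<close> and leaves only the error
    vectors. The bound \<open>e \<le> 1/20\<close> keeps \<open>\<beta>\<close> of the order of
    \<open>d\<close>.\<close>
  define \<mu> where "\<mu> = \<gamma> / \<beta>"
  have \<beta>0: "\<beta> \<noteq> 0" using \<beta> d by auto
  have "\<bar>\<mu>\<bar> \<le> 4"
    using \<beta> \<gamma> d \<beta>0 unfolding \<mu>_def abs_divide by (subst pos_divide_le_eq) auto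
  have "z - x - \<mu> *\<^sub>R (y - x) = z' - \<mu> *\<^sub>R y'"
    using \<beta>0 by (simp add: yb zc \<mu>_def algebra_simps)
  then have "norm (z - x - \<mu> *\<^sub>R (y - x)) \<le> norm z' + \<bar>\<mu>\<bar> * norm y'"
    by (metis norm_scaleR norm_triangle_ineq4)
  also have "\<dots> \<le> E + 4 * E" using z' y' \<open>\<bar>\<mu>\<bar> \<le> 4\<close> by (intro add_mono mult_mono) auto
  finally have "norm (z - x - \<mu> *\<^sub>R (y - x)) \<le> 15 * e * d" unfolding E_def by linarith
  then show ?thesis ..
qed

text \<open>The reciprocal radius is twice the distance to the tangent line divided by the squared
  chord, hence at least \<open>2 * h / R\<^sup>2\<close>.\<close>

lemma ennreal_powr_inverse_radius_ge:
  fixes \<Gamma> :: "real \<Rightarrow> 'a::euclidean_space"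
  assumes "0 < h" "h \<le> infdist (\<Gamma> s) (tangent_line \<Gamma> t)" "norm (\<Gamma> t - \<Gamma> s) \<le> R" "0 < q"
    and K: "0 \<le> K" "K * R\<^sup>2 \<le> 2 * h"
  shows "ennreal (K powr q) \<le> ennreal_powr (inverse (tangent_point_radius \<Gamma> t s)) q"
proof (cases "\<Gamma> t = \<Gamma> s")
  case True
  \<comment> \<open>Here the radius is 0 by definition, and its inverse in \<open>ennreal\<close> is
    \<infinity>.\<close>
  then show ?thesis by (simp add: tangent_point_radius_def ennreal_powr_def)
next
  case False
  define D where "D = 2 * infdist (\<Gamma> s) (tangent_line \<Gamma> t)"
  define N where "N = (norm (\<Gamma> t - \<Gamma> s))\<^sup>2"
  have N: "N > 0" "N \<le> R\<^sup>2" using False assms by (auto simp: N_def intro: power_mono)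
  have D: "2 * h \<le> D" "D > 0" using assms by (auto simp: D_def)
  have "tangent_point_radius \<Gamma> t s = ennreal (N / D)"
    using False N D by (simp add: tangent_point_radius_def D_def[symmetric] N_def[symmetric] divide_ennreal)
  then have r: "inverse (tangent_point_radius \<Gamma> t s) = ennreal (D / N)"
    using N D by (simp add: inverse_ennreal)
  have "K * N \<le> D" using mult_left_mono[OF N(2) K(1)] K(2) D(1) by linarith
  then have "K \<le> D / N" using N by (simp add: field_simps)
  then have "K powr q \<le> (D / N) powr q" using K assms(4) by (intro powr_mono2) auto
  then show ?thesis using N D by (simp add: r ennreal_powr_def ennreal_leI)
qed

lemma infdist_lessD:
  assumes "infdist x A < h" "A \<noteq> {}"
  shows "\<exists>a\<in>A. dist x a < h"
  using assms cInf_lessD[of "dist x ` A" h] by (auto simp: infdist_notempty)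

text \<open>The base \<open>e / (3 * d)\<close> bounds \<open>1 / r\<close> from below when
  \<open>t\<close> runs through the arc at \<open>x\<close> and \<open>s\<close> through an arc that
  the tangent line at \<open>t\<close> avoids; the square is the area swept by two arcs of length
  \<open>e * d\<close>.\<close>

lemma tangent_point_energy_lower_bound:
  fixes \<Gamma> :: "real \<Rightarrow> 'a::euclidean_space"
  assumes L: "L > 0" and arc: "arclength_param L \<Gamma>" and q: "q > 0" and e: "0 < e" "e \<le> 1/20"
    and rng: "x \<in> range \<Gamma>" "y \<in> range \<Gamma>" "z \<in> range \<Gamma>"
    and d: "d = norm (y - x)" "d > 0" and z: "norm (z - x) \<le> 2 * d"
    and far: "\<And>\<mu>. 15 * e * d < norm (z - x - \<mu> *\<^sub>R (y - x))"
  shows "ennreal ((e / (3 * d)) powr q * (e * d)\<^sup>2) \<le> tangent_point_energy q L \<Gamma>"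
proof -
  note lip = arclength_param_norm_le[OF arc]
  have ex: "\<exists>a. 0 \<le> a \<and> a \<le> L \<and> \<Gamma> a = w" if w: "w \<in> range \<Gamma>" for w
  proof -
    obtain t where "w = \<Gamma> t" using w by auto
    moreover obtain k where "t + of_int k * L \<in> {0..<0+L}" "\<Gamma> (t + of_int k * L) = \<Gamma> t"
      by (rule arclength_param_reduce[OF arc L])
    ultimately show ?thesis by (intro exI[of _ "t + of_int k * L"]) auto
  qed
  obtain a where a: "0 \<le> a" "a \<le> L" "\<Gamma> a = x" using ex[OF rng(1)] by blast
  obtain b where b: "0 \<le> b" "b \<le> L" "\<Gamma> b = y" using ex[OF rng(2)] by blast
  obtain c where c: "0 \<le> c" "c \<le> L" "\<Gamma> c = z" using ex[OF rng(3)] by blast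
  define h where "h = e * d"
  have h: "h > 0" "20 * h \<le> d" using e d by (auto simp: h_def)
  have "d \<le> L" using lip[of b a] a b d by auto
  then have hL: "2 * h \<le> L" using h by linarith
  \<comment> \<open>The arcs start or end at the given parameter, so that they need not wrap around
    the interval \<open>{0..L}\<close>; \<open>2 * h \<le> L\<close> ensures that one of the two
    choices fits.\<close>
  have arc_ex: "\<exists>l. 0 \<le> l \<and> l + h \<le> L \<and> (\<forall>t\<in>{l..l+h}. norm (\<Gamma> t - \<Gamma> w) \<le> h)" if "0 \<le> w" "w \<le> L" for w
  proof -
    obtain l where l: "0 \<le> l" "l + h \<le> L" "\<And>t. t \<in> {l..l+h} \<Longrightarrow> \<bar>t - w\<bar> \<le> h"
    proof (cases "w + h \<le> L")
      case True
      show thesis by (rule that[of w]) (use True \<open>0 \<le> w\<close> h in auto)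
    next
      case False
      show thesis by (rule that[of "w - h"]) (use False \<open>w \<le> L\<close> hL in auto)
    qed
    then have "norm (\<Gamma> t - \<Gamma> w) \<le> h" if "t \<in> {l..l+h}" for t
      using lip[of t w] l(3)[OF that] by linarith
    then show ?thesis using l(1,2) by blast
  qed
  obtain la where I: "0 \<le> la" "la + h \<le> L" "\<And>t. t \<in> {la..la+h} \<Longrightarrow> norm (\<Gamma> t - x) \<le> h"
    using arc_ex[OF a(1,2)] a(3) by blast
  obtain lb where Jb: "0 \<le> lb" "lb + h \<le> L" "\<And>t. t \<in> {lb..lb+h} \<Longrightarrow> norm (\<Gamma> t - y) \<le> h"
    using arc_ex[OF b(1,2)] b(3) by blast
  obtain lc where Jc: "0 \<le> lc" "lc + h \<le> L" "\<And>t. t \<in> {lc..lc+h} \<Longrightarrow> norm (\<Gamma> t - z) \<le> h"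
    using arc_ex[OF c(1,2)] c(3) by blast
  define K where "K = (e / (3 * d)) powr q"
  have K: "K \<ge> 0" by (simp add: K_def)
  define good where "good = {t \<in> {0..L}. \<Gamma> differentiable (at t) \<and> norm (vector_derivative \<Gamma> (at t)) = 1}"
  define f where "f t s = ennreal_powr (inverse (tangent_point_radius \<Gamma> t s)) q" for t s
  have f_ge: "ennreal K \<le> f t s"
    if "h \<le> infdist (\<Gamma> s) (tangent_line \<Gamma> t)" "norm (\<Gamma> t - x) \<le> h" "norm (\<Gamma> s - w) \<le> h" "norm (w - x) \<le> 2 * d"
    for t s w
    unfolding K_def f_def
  proof (rule ennreal_powr_inverse_radius_ge[OF h(1) that(1) _ q])
    have "\<Gamma> t - \<Gamma> s = (\<Gamma> t - x) - (\<Gamma> s - w) - (w - x)" by simp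
    then have "norm (\<Gamma> t - \<Gamma> s) \<le> norm (\<Gamma> t - x) + norm (\<Gamma> s - w) + norm (w - x)"
      by (smt (verit) norm_triangle_ineq4)
    \<comment> \<open>The chord is at most \<open>2 * d + 2 * h\<close>, and \<open>2 * h\<close> is
      at most a tenth of \<open>d\<close>. Half of \<open>(11/5)\<^sup>2\<close> is 2.42, rounded up
      to the 3 in \<open>K\<close>.\<close>
    then show "norm (\<Gamma> t - \<Gamma> s) \<le> 11/5 * d" using that h by linarith
    show "e / (3 * d) * (11 / 5 * d)\<^sup>2 \<le> 2 * h" using d e by (simp add: h_def power2_eq_square)
  qed (use e d in auto)
  have inner: "ennreal (K * h) \<le> (\<integral>\<^sup>+ s \<in> {0..L}. f t s \<partial>lborel)" if t: "t \<in> good" "t \<in> {la..la+h}" for t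
  proof -
    define u where "u = vector_derivative \<Gamma> (at t)"
    have u: "norm u = 1" using t by (simp add: good_def u_def)
    have line: "\<exists>\<beta>. norm (w - (\<Gamma> t + \<beta> *\<^sub>R u)) \<le> 2 * e * d"
      if inf: "infdist (\<Gamma> s) (tangent_line \<Gamma> t) < h" and sw: "norm (\<Gamma> s - w) \<le> h" for s w
    proof -
      have "tangent_line \<Gamma> t \<noteq> {}" by (auto simp: tangent_line_def)
      then obtain \<beta> where "dist (\<Gamma> s) (\<Gamma> t + \<beta> *\<^sub>R u) < h"
        using infdist_lessD[OF inf] by (auto simp: tangent_line_def u_def)
      moreover have "dist w (\<Gamma> t + \<beta> *\<^sub>R u) \<le> dist w (\<Gamma> s) + dist (\<Gamma> s) (\<Gamma> t + \<beta> *\<^sub>R u)"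
        by (rule dist_triangle)
      ultimately have "dist w (\<Gamma> t + \<beta> *\<^sub>R u) \<le> 2 * h"
        using sw by (simp add: dist_norm norm_minus_commute)
      then show ?thesis by (auto simp: dist_norm h_def mult.assoc)
    qed
    have tx: "norm (\<Gamma> t - x) \<le> e * d" using I(3)[OF t(2)] by (simp add: h_def)
    \<comment> \<open>Which of the two arcs is avoided may change with \<open>t\<close>. Both have
      length \<open>h\<close>, so the inner integral has the same lower bound either way.\<close>
    have "(\<forall>s\<in>{lb..lb+h}. h \<le> infdist (\<Gamma> s) (tangent_line \<Gamma> t)) \<or>
          (\<forall>s\<in>{lc..lc+h}. h \<le> infdist (\<Gamma> s) (tangent_line \<Gamma> t))"
    proof (rule ccontr)
      assume "\<not> ?thesis"
      then obtain s s' where "s \<in> {lb..lb+h}" "infdist (\<Gamma> s) (tangent_line \<Gamma> t) < h"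
        "s' \<in> {lc..lc+h}" "infdist (\<Gamma> s') (tangent_line \<Gamma> t) < h" by (auto simp: not_le)
      then obtain \<beta> \<gamma> where "norm (y - (\<Gamma> t + \<beta> *\<^sub>R u)) \<le> 2 * e * d" "norm (z - (\<Gamma> t + \<gamma> *\<^sub>R u)) \<le> 2 * e * d"
        using line[OF _ Jb(3)] line[OF _ Jc(3)] by blast
      from three_points_near_line[OF u d z e tx this] far show False by (meson not_le)
    qed
    then obtain l where l: "0 \<le> l" "l + h \<le> L" "\<And>s. s \<in> {l..l+h} \<Longrightarrow> ennreal K \<le> f t s"
    proof (elim disjE)
      assume "\<forall>s\<in>{lb..lb+h}. h \<le> infdist (\<Gamma> s) (tangent_line \<Gamma> t)"
      then show thesis using that[of lb] Jb f_ge[of _ t y] I(3)[OF t(2)] d by auto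
    next
      assume "\<forall>s\<in>{lc..lc+h}. h \<le> infdist (\<Gamma> s) (tangent_line \<Gamma> t)"
      then show thesis using that[of lc] Jc f_ge[of _ t z] I(3)[OF t(2)] z by auto
    qed
    have "ennreal (K * h) = (\<integral>\<^sup>+ s. ennreal K * indicator {l..l+h} s \<partial>lborel)"
      using h K by (simp add: nn_integral_cmult_indicator ennreal_mult)
    also have "\<dots> \<le> (\<integral>\<^sup>+ s \<in> {0..L}. f t s \<partial>lborel)"
      using l by (intro nn_integral_mono) (auto simp: indicator_def)
    finally show ?thesis .
  qed
  have "AE t in lborel. \<Gamma> differentiable (at t) \<and> norm (vector_derivative \<Gamma> (at t)) = 1"
    using arc by (simp add: arclength_param_def)
  then have ae: "AE t in lborel. t \<in> {la..la+h} \<longrightarrow> t \<in> good"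
    by eventually_elim (use I in \<open>auto simp: good_def\<close>)
  have "ennreal (K * h * h) = (\<integral>\<^sup>+ t. ennreal (K * h) * indicator {la..la+h} t \<partial>lborel)"
    using h K by (simp add: nn_integral_cmult_indicator ennreal_mult)
  also have "\<dots> \<le> (\<integral>\<^sup>+ t \<in> good. (\<integral>\<^sup>+ s \<in> {0..L}. f t s \<partial>lborel) \<partial>lborel)"
    using ae by (intro nn_integral_mono_AE, eventually_elim) (use inner in \<open>auto simp: indicator_def\<close>)
  also have "\<dots> = tangent_point_energy q L \<Gamma>"
    by (simp add: tangent_point_energy_def good_def f_def)
  finally show ?thesis by (simp add: K_def h_def power2_eq_square mult_ac)
qed

section \<open>Directions of chords\<close>

text \<open>The chordal distance on projective space: unit vectors up to sign. Chords issuing from a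
  point may leave it on either side, so their orientations cannot be matched.\<close>

definition line_dev :: "'a::real_normed_vector \<Rightarrow> 'a \<Rightarrow> real" where
  "line_dev u v = min (norm (sgn u - sgn v)) (norm (sgn u + sgn v))"

lemma line_dev_commute: "line_dev u v = line_dev v u"
  by (simp add: line_dev_def norm_minus_commute add.commute)

lemma line_dev_minus_left [simp]: "line_dev (- u) v = line_dev u v"
proof -
  have "norm (- sgn u - sgn v) = norm (sgn u + sgn v)"
    using norm_minus_cancel[of "sgn u + sgn v"] by (simp add: algebra_simps)
  moreover have "norm (- sgn u + sgn v) = norm (sgn u - sgn v)"
    by (metis add.commute norm_minus_commute uminus_add_conv_diff)
  ultimately show ?thesis by (simp add: line_dev_def sgn_minus min.commute)
qed

lemma line_dev_refl [simp]: "line_dev u u = 0"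
  by (simp add: line_dev_def)

lemma line_dev_triangle: "line_dev u w \<le> line_dev u v + line_dev v w"
proof -
  have "norm (sgn u - sgn w) \<le> norm (sgn u - sgn v) + norm (sgn v - sgn w)"
    using norm_triangle_ineq[of "sgn u - sgn v" "sgn v - sgn w"] by simp
  moreover have "norm (sgn u - sgn w) \<le> norm (sgn u + sgn v) + norm (sgn v + sgn w)"
    using norm_triangle_ineq4[of "sgn u + sgn v" "sgn v + sgn w"] by simp
  moreover have "norm (sgn u + sgn w) \<le> norm (sgn u - sgn v) + norm (sgn v + sgn w)"
    using norm_triangle_ineq[of "sgn u - sgn v" "sgn v + sgn w"] by simp
  moreover have "norm (sgn u + sgn w) \<le> norm (sgn u + sgn v) + norm (sgn v - sgn w)"
    using norm_triangle_ineq4[of "sgn u + sgn v" "sgn v - sgn w"] by simp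
  ultimately show ?thesis unfolding line_dev_def by linarith
qed

text \<open>After normalising both vectors, the coefficient of \<open>sgn v\<close> lies within
  \<open>e\<close> of 1 or -1; replacing it by that sign costs a second \<open>e\<close>.\<close>

lemma line_dev_le:
  assumes "u \<noteq> 0" "v \<noteq> 0" "norm (u - \<mu> *\<^sub>R v) \<le> e * norm u"
  shows "line_dev u v \<le> 2 * e"
proof -
  define c where "c = \<mu> * norm v / norm u"
  have "sgn u - c *\<^sub>R sgn v = (1 / norm u) *\<^sub>R (u - \<mu> *\<^sub>R v)"
    using assms by (simp add: c_def sgn_div_norm scaleR_diff_right field_simps)
  then have "norm (sgn u - c *\<^sub>R sgn v) = norm (u - \<mu> *\<^sub>R v) / norm u" by simp
  then have 1: "norm (sgn u - c *\<^sub>R sgn v) \<le> e" using assms by (simp add: pos_divide_le_eq)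
  have n: "norm (sgn u) = 1" "norm (sgn v) = 1" using assms by (auto simp: norm_sgn)
  have 2: "\<bar>1 - \<bar>c\<bar>\<bar> \<le> e" using norm_triangle_ineq3[of "sgn u" "c *\<^sub>R sgn v"] 1 n by simp
  show ?thesis
  proof (cases "c \<ge> 0")
    case True
    have "norm (sgn u - sgn v) \<le> norm (sgn u - c *\<^sub>R sgn v) + norm ((c - 1) *\<^sub>R sgn v)"
      using norm_triangle_ineq[of "sgn u - c *\<^sub>R sgn v" "(c - 1) *\<^sub>R sgn v"] by (simp add: algebra_simps)
    then show ?thesis using 1 2 n True by (simp add: line_dev_def)
  next
    case False
    have "norm (sgn u + sgn v) \<le> norm (sgn u - c *\<^sub>R sgn v) + norm ((c + 1) *\<^sub>R sgn v)"
      using norm_triangle_ineq[of "sgn u - c *\<^sub>R sgn v" "(c + 1) *\<^sub>R sgn v"] by (simp add: algebra_simps)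
    then show ?thesis using 1 2 n False by (simp add: line_dev_def)
  qed
qed

lemma orthogonal_component_minimal:
  fixes u v :: "'a::real_inner"
  assumes "norm v = 1"
  shows "norm (u - (u \<bullet> v) *\<^sub>R v) \<le> norm (u - c *\<^sub>R v)"
proof -
  have v: "v \<bullet> v = 1" using assms by (simp add: dot_square_norm)
  have "(norm (u - (u \<bullet> v) *\<^sub>R v))\<^sup>2 + (c - u \<bullet> v)\<^sup>2 = (norm (u - c *\<^sub>R v))\<^sup>2"
    unfolding power2_norm_eq_inner using v
    by (simp add: inner_diff_left inner_diff_right inner_commute power2_eq_square algebra_simps)
  then have "(norm (u - (u \<bullet> v) *\<^sub>R v))\<^sup>2 \<le> (norm (u - c *\<^sub>R v))\<^sup>2"
    by (smt (verit) zero_le_power2)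
  then show ?thesis by (rule power2_le_imp_le) simp
qed

lemma orthogonal_component_le_line_dev:
  fixes u v :: "'a::real_inner"
  assumes "norm v = 1"
  shows "norm (u - (u \<bullet> v) *\<^sub>R v) \<le> line_dev u v * norm u"
proof (cases "u = 0")
  case False
  have sv: "sgn v = v" using assms by (simp add: sgn_div_norm)
  have u: "norm u *\<^sub>R sgn u = u" using False by (simp add: sgn_div_norm)
  have "u - norm u *\<^sub>R v = norm u *\<^sub>R (sgn u - sgn v)"
    by (simp add: u sv scaleR_diff_right)
  then have "norm (u - norm u *\<^sub>R v) = norm u * norm (sgn u - sgn v)" by simp
  moreover have "u - (- norm u) *\<^sub>R v = norm u *\<^sub>R (sgn u + sgn v)"
    by (simp add: u sv scaleR_add_right)
  then have "norm (u - (- norm u) *\<^sub>R v) = norm u * norm (sgn u + sgn v)"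
    by (simp only: norm_scaleR abs_norm_cancel)
  ultimately show ?thesis
    using orthogonal_component_minimal[OF assms, of u "norm u"]
      orthogonal_component_minimal[OF assms, of u "- norm u"]
    by (simp add: line_dev_def min_def mult.commute)
qed simp

lemma connected_attains_dist:
  assumes "connected A" "x \<in> A" "z \<in> A" "0 \<le> h" "h \<le> dist z x"
  shows "\<exists>y\<in>A. dist y x = h"
proof -
  have "connected ((\<lambda>y. dist y x) ` A)"
    by (intro connected_continuous_image continuous_intros assms)
  then have "h \<in> (\<lambda>y. dist y x) ` A"
    using connected_contains_Icc[of "(\<lambda>y. dist y x) ` A" 0 "dist z x"] assms
    by (force simp: image_iff subset_iff)
  then show ?thesis by auto
qed

text \<open>
  Inserting points of \<open>A\<close> at the distances \<open>norm (z - x) / 2 ^ k\<close> from \<open>x\<close>, consecutive directions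
  differ by the terms of a geometric series.
\<close>

lemma line_dev_chords_le:
  fixes A :: "'a::real_normed_vector set"
  assumes A: "connected A" and \<alpha>: "\<alpha> > 0" and R: "R > 0" and M: "M \<ge> 0"
    and K: "M \<le> K * (1 - 2 powr (-\<alpha>))"
    and flat: "\<And>x y z. x \<in> A \<Longrightarrow> y \<in> A \<Longrightarrow> z \<in> A \<Longrightarrow> y \<noteq> x \<Longrightarrow> norm (y - x) \<le> norm (z - x) \<Longrightarrow>
      norm (z - x) \<le> 2 * norm (y - x) \<Longrightarrow> norm (z - x) \<le> R \<Longrightarrow>
      line_dev (y - x) (z - x) \<le> M * (norm (z - x) / R) powr \<alpha>"
    and xyz: "x \<in> A" "y \<in> A" "z \<in> A" "y \<noteq> x" "norm (y - x) \<le> norm (z - x)" "norm (z - x) \<le> R"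
  shows "line_dev (y - x) (z - x) \<le> K * (norm (z - x) / R) powr \<alpha>"
proof -
  have \<alpha>2: "0 < 1 - 2 powr (-\<alpha>)" "0 < 2 powr (-\<alpha>)" using \<alpha> by (auto simp: powr_less_one)
  have "0 \<le> K * (1 - 2 powr (-\<alpha>))" using M K by linarith
  then have "K \<ge> 0" using \<alpha>2(1) by (simp add: zero_le_mult_iff)
  then have "0 \<le> K * 2 powr (-\<alpha>)" by simp
  then have MK: "M \<le> K" using K by (simp add: algebra_simps)
  have "line_dev (y - x) (z - x) \<le> K * (norm (z - x) / R) powr \<alpha>"
    if "z \<in> A" "norm (y - x) \<le> norm (z - x)" "norm (z - x) \<le> R" "norm (z - x) \<le> 2 ^ n * norm (y - x)" for n z
    using that
  proof (induction n arbitrary: z)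
    case 0
    then have "line_dev (y - x) (z - x) \<le> M * (norm (z - x) / R) powr \<alpha>"
      using flat[of x y z] xyz by auto
    also have "\<dots> \<le> K * (norm (z - x) / R) powr \<alpha>" using MK by (intro mult_right_mono) auto
    finally show ?case .
  next
    case (Suc n)
    define D where "D = norm (z - x)"
    have D: "D > 0" using Suc.prems xyz unfolding D_def by (smt (verit) norm_le_zero_iff right_minus_eq)
    show ?case
    proof (cases "D \<le> 2 * norm (y - x)")
      case True
      then have "line_dev (y - x) (z - x) \<le> M * (norm (z - x) / R) powr \<alpha>"
        using flat[of x y z] xyz Suc.prems by (auto simp: D_def)
      also have "\<dots> \<le> K * (norm (z - x) / R) powr \<alpha>" using MK by (intro mult_right_mono) auto
      finally show ?thesis .
    next
      case False
      obtain y' where y': "y' \<in> A" "norm (y' - x) = D / 2"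
        using connected_attains_dist[OF A xyz(1) Suc.prems(1), of "D/2"] D
        by (auto simp: dist_norm D_def)
      have y'D: "y' \<noteq> x" "norm (y' - x) \<le> D" "D \<le> 2 * norm (y' - x)" using y' D by auto
      have "line_dev (y - x) (y' - x) \<le> K * (norm (y' - x) / R) powr \<alpha>"
        using Suc.prems y' False D by (intro Suc.IH) (simp_all add: D_def[symmetric])
      moreover have "line_dev (y' - x) (z - x) \<le> M * (norm (z - x) / R) powr \<alpha>"
        using flat[of x y' z] y'D y'(1) xyz(1) Suc.prems(1,3) unfolding D_def by blast
      moreover have "(norm (y' - x) / R) powr \<alpha> = 2 powr (-\<alpha>) * (D / R) powr \<alpha>"
        unfolding y'(2) using D R by (simp add: powr_divide powr_minus_divide powr_mult)
      ultimately have "line_dev (y - x) (z - x) \<le> (K * 2 powr (-\<alpha>) + M) * (D / R) powr \<alpha>"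
        using line_dev_triangle[of "y - x" "z - x" "y' - x"] by (simp add: D_def algebra_simps)
      \<comment> \<open>The hypothesis relating \<open>M\<close> and \<open>K\<close> is made for
        this recursion to close: \<open>K\<close> dominates the sum of the geometric series with
        first term \<open>M\<close> and ratio \<open>2 powr (-\<alpha>)\<close>.\<close>
      also have "\<dots> \<le> K * (D / R) powr \<alpha>" using K by (intro mult_right_mono) (auto simp: algebra_simps)
      finally show ?thesis by (simp add: D_def)
    qed
  qed
  moreover obtain n where "norm (z - x) / norm (y - x) < 2 ^ n" using real_arch_pow[of 2] by auto
  then have "norm (z - x) \<le> 2 ^ n * norm (y - x)" using xyz(4) by (simp add: field_simps)
  ultimately show ?thesis using xyz by blast
qed

text \<open>\<open>c\<close> precedes the curve and its energy in the order of quantifiers; this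
  makes the final \<open>\<delta>\<close> depend on \<open>q\<close> alone.\<close>

lemma tangent_point_energy_imp_flat_chords:
  fixes q \<eta> :: real
  assumes q: "q > 2" and \<eta>: "\<eta> > 0"
  shows "\<exists>c>0. \<forall>L (\<Gamma> :: real \<Rightarrow> 'a::euclidean_space) E x y z.
    L > 0 \<longrightarrow> arclength_param L \<Gamma> \<longrightarrow> E > 0 \<longrightarrow> tangent_point_energy q L \<Gamma> \<le> ennreal E \<longrightarrow>
    x \<in> range \<Gamma> \<longrightarrow> y \<in> range \<Gamma> \<longrightarrow> z \<in> range \<Gamma> \<longrightarrow> y \<noteq> x \<longrightarrow> z \<noteq> x \<longrightarrow>
    norm (y - x) \<le> c * E powr (- (1 / (q - 2))) \<longrightarrow> norm (z - x) \<le> c * E powr (- (1 / (q - 2))) \<longrightarrow>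
    line_dev (y - x) (z - x) \<le> \<eta>"
proof -
  \<comment> \<open>With \<open>e = e0 * (d / R) powr \<alpha>\<close> this exponent makes the
    energy bound, a constant times \<open>e powr (q + 2) * d powr (2 - q)\<close>, independent of
    the scale \<open>d\<close>.\<close>
  define \<alpha> where "\<alpha> = (q - 2) / (q + 2)"
  have \<alpha>: "\<alpha> > 0" "\<alpha> * (q + 2) = q - 2" using q by (auto simp: \<alpha>_def)
  have p: "0 < 1 - 2 powr (-\<alpha>)" using \<alpha> by (auto simp: powr_less_one)
  \<comment> \<open>The 30 is twice the 15 of \<open>tangent_point_energy_lower_bound\<close>,
    doubled by \<open>line_dev_le\<close>. The second bound lets the geometric series over the
    scales sum up to at most \<eta>.\<close>
  define e0 where "e0 = min (1/20) (\<eta> * (1 - 2 powr (-\<alpha>)) / 30)"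
  have e0: "0 < e0" "e0 \<le> 1/20" "30 * e0 \<le> \<eta> * (1 - 2 powr (-\<alpha>))" using \<eta> p by (auto simp: e0_def)
  \<comment> \<open>Chosen so that violated flatness at any scale up to \<open>R\<close> forces the
    energy to be at least \<open>2 * E\<close>; the strict excess over \<open>E\<close> is the
    contradiction.\<close>
  define k where "k = 2 * 3 powr q * e0 powr (- (q + 2))"
  have k: "k > 0" using e0 by (simp add: k_def)
  define c where "c = k powr (- (1 / (q - 2)))"
  have c: "c > 0" using k by (simp add: c_def)
  have "line_dev (y - x) (z - x) \<le> \<eta>"
    if L: "L > 0" and arc: "arclength_param L \<Gamma>" and E: "E > 0" and energy: "tangent_point_energy q L \<Gamma> \<le> ennreal E"
      and xyz: "x \<in> range \<Gamma>" "y \<in> range \<Gamma>" "z \<in> range \<Gamma>" "y \<noteq> x" "z \<noteq> x"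
      and dist: "norm (y - x) \<le> c * E powr (- (1 / (q - 2)))" "norm (z - x) \<le> c * E powr (- (1 / (q - 2)))"
    for L E and \<Gamma> :: "real \<Rightarrow> 'a" and x y z
  proof -
    define R where "R = c * E powr (- (1 / (q - 2)))"
    have R: "R > 0" using c E by (simp add: R_def)
    have lnR: "(q - 2) * ln R = - ln k - ln E"
    proof -
      have "ln R = - (1 / (q - 2)) * (ln k + ln E)"
        using c E k by (simp add: R_def c_def ln_mult ln_powr algebra_simps add_divide_distrib)
      then show ?thesis using q by simp
    qed
    have conn: "connected (range \<Gamma>)"
      using arclength_param_lipschitz[OF arc] lipschitz_on_continuous_on
      by (intro connected_continuous_image) auto
    have flat: "line_dev (y - x) (z - x) \<le> (30 * e0) * (norm (z - x) / R) powr \<alpha>"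
      if xyz: "x \<in> range \<Gamma>" "y \<in> range \<Gamma>" "z \<in> range \<Gamma>" "y \<noteq> x" and yz: "norm (y - x) \<le> norm (z - x)"
        "norm (z - x) \<le> 2 * norm (y - x)" and zR: "norm (z - x) \<le> R" for x y z
    proof -
      define d where "d = norm (y - x)"
      have d: "d > 0" "d \<le> R" using xyz yz zR by (auto simp: d_def)
      define e where "e = e0 * (d / R) powr \<alpha>"
      have "(d / R) powr \<alpha> \<le> 1" using d R \<alpha> by (intro powr_le1) auto
      then have "e \<le> e0" using e0 by (simp add: e_def)
      moreover have "0 < e" using e0 d R by (simp add: e_def)
      ultimately have e: "0 < e" "e \<le> 1/20" using e0 by auto
      \<comment> \<open>Logarithms turn the identity with value \<open>2 * E\<close> into linear
        arithmetic, in which the terms with \<open>ln d\<close> cancel.\<close>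
      have "ln ((e / (3 * d)) powr q * (e * d)\<^sup>2) = q * (ln e - ln 3 - ln d) + 2 * (ln e + ln d)"
        using e d by (simp add: ln_mult ln_powr ln_div ln_realpow)
      also have "\<dots> = (q + 2) * ln e - q * ln 3 + (2 - q) * ln d" by (simp add: algebra_simps)
      also have "(q + 2) * ln e = (q + 2) * ln e0 + (\<alpha> * (q + 2)) * (ln d - ln R)"
        using e0 d R by (simp add: e_def ln_mult ln_powr ln_div algebra_simps)
      also have "(q + 2) * ln e0 + (\<alpha> * (q + 2)) * (ln d - ln R) - q * ln 3 + (2 - q) * ln d
          = (q + 2) * ln e0 - q * ln 3 - (q - 2) * ln R"
        unfolding \<alpha>(2) by (simp add: algebra_simps)
      also have "\<dots> = ln (2 * E)"
        unfolding lnR using e0 E by (simp add: k_def ln_mult ln_powr algebra_simps)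
      finally have "(e / (3 * d)) powr q * (e * d)\<^sup>2 = 2 * E" using e d E by simp
      moreover have "ennreal E < ennreal (2 * E)" using E by (intro ennreal_lessI) auto
      ultimately have "\<not> ennreal ((e / (3 * d)) powr q * (e * d)\<^sup>2) \<le> tangent_point_energy q L \<Gamma>"
        using energy by (metis not_le order.strict_trans1)
      moreover have "0 < q" "norm (z - x) \<le> 2 * d" using q yz by (auto simp: d_def)
      note tangent_point_energy_lower_bound[OF L arc this(1) e xyz(1-3) d_def d(1) this(2)]
      ultimately have "\<exists>\<mu>. \<not> 15 * e * d < norm (z - x - \<mu> *\<^sub>R (y - x))" by blast
      then obtain \<mu> where "norm (z - x - \<mu> *\<^sub>R (y - x)) \<le> 15 * e * d" by (auto simp: not_less)
      also have "\<dots> \<le> 15 * e * norm (z - x)" using yz e by (intro mult_left_mono) (auto simp: d_def)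
      finally have "line_dev (z - x) (y - x) \<le> 2 * (15 * e)"
        using xyz yz by (intro line_dev_le) auto
      also have "\<dots> \<le> (30 * e0) * (norm (z - x) / R) powr \<alpha>"
        using e0 d R yz \<alpha> by (auto simp: e_def d_def intro!: mult_left_mono powr_mono2 divide_right_mono)
      finally show ?thesis by (simp add: line_dev_commute)
    qed
    have main: "line_dev (y - x) (z - x) \<le> \<eta>"
      if "y \<in> range \<Gamma>" "z \<in> range \<Gamma>" "y \<noteq> x" "norm (y - x) \<le> norm (z - x)" "norm (z - x) \<le> R" for y z
    proof -
      have "line_dev (y - x) (z - x) \<le> \<eta> * (norm (z - x) / R) powr \<alpha>"
        by (rule line_dev_chords_le[OF conn \<alpha>(1) R _ e0(3) flat]) (use e0 xyz that in auto)
      also have "\<dots> \<le> \<eta> * 1" using that R \<eta> \<alpha> by (intro mult_left_mono powr_le1) auto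
      finally show ?thesis by simp
    qed
    show ?thesis
      using main[of y z] main[of z y] xyz dist
      by (cases "norm (y - x) \<le> norm (z - x)") (auto simp: R_def line_dev_commute)
  qed
  then show ?thesis using c by blast
qed

text \<open>A cone condition: all chords of \<open>S\<close> lie in a narrow double cone around the
  axis \<open>v\<close>. For a unit vector \<open>v\<close> and \<theta> < 1 this makes
  \<open>S\<close> a Lipschitz graph over a subset of the axis.\<close>

definition nearly_straight :: "real \<Rightarrow> 'a::real_inner \<Rightarrow> 'a set \<Rightarrow> bool" where
  "nearly_straight \<theta> v S \<longleftrightarrow> (\<forall>y\<in>S. \<forall>z\<in>S. norm ((y - z) - ((y - z) \<bullet> v) *\<^sub>R v) \<le> \<theta> * norm (y - z))"

lemma nearly_straightD:
  "nearly_straight \<theta> v S \<Longrightarrow> y \<in> S \<Longrightarrow> z \<in> S \<Longrightarrow> norm ((y - z) - ((y - z) \<bullet> v) *\<^sub>R v) \<le> \<theta> * norm (y - z)"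
  by (simp add: nearly_straight_def)

lemma nearly_straight_norm_le:
  assumes "nearly_straight \<theta> v S" "norm v = 1" "y \<in> S" "z \<in> S"
  shows "(1 - \<theta>) * norm (y - z) \<le> \<bar>(y - z) \<bullet> v\<bar>"
proof -
  have "norm (y - z) \<le> norm (((y - z) \<bullet> v) *\<^sub>R v) + norm ((y - z) - ((y - z) \<bullet> v) *\<^sub>R v)"
    using norm_triangle_ineq[of "((y - z) \<bullet> v) *\<^sub>R v" "(y - z) - ((y - z) \<bullet> v) *\<^sub>R v"] by simp
  also have "\<dots> \<le> \<bar>(y - z) \<bullet> v\<bar> + \<theta> * norm (y - z)"
    using nearly_straightD[OF assms(1,3,4)] assms(2) by simp
  finally show ?thesis by (simp add: left_diff_distrib)
qed

lemma nearly_straight_minus: "nearly_straight \<theta> (- v) S \<longleftrightarrow> nearly_straight \<theta> v S"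
  by (simp add: nearly_straight_def)

text \<open>Flatness compares only chords with a common endpoint. The chord from \<open>z\<close> to
  \<open>y\<close> is compared with the one from \<open>z\<close> to \<open>x\<close>, and that with
  the reference chord from \<open>x\<close> to \<open>w\<close>. The two comparisons double \<eta>;
  halving the radius keeps \<open>y\<close> within \<open>R\<close> of \<open>z\<close>.\<close>

lemma flat_chords_imp_nearly_straight:
  fixes A :: "'a::real_inner set"
  assumes flat: "\<And>x y z. x \<in> A \<Longrightarrow> y \<in> A \<Longrightarrow> z \<in> A \<Longrightarrow> y \<noteq> x \<Longrightarrow> z \<noteq> x \<Longrightarrow>
      norm (y - x) \<le> R \<Longrightarrow> norm (z - x) \<le> R \<Longrightarrow> line_dev (y - x) (z - x) \<le> \<eta>"
    and xw: "x \<in> A" "w \<in> A" "w \<noteq> x" "norm (w - x) \<le> R / 2"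
  shows "nearly_straight (2 * \<eta>) (sgn (w - x)) (A \<inter> cball x (R / 2))"
  unfolding nearly_straight_def
proof (intro ballI)
  fix y z assume yz: "y \<in> A \<inter> cball x (R / 2)" "z \<in> A \<inter> cball x (R / 2)"
  have R: "R > 0" using xw by (smt (verit) divide_nonpos_pos norm_le_zero_iff right_minus_eq)
  have \<eta>: "\<eta> \<ge> 0" using flat[OF xw(1,2,2,3,3)] xw R by auto
  have n: "norm (sgn (w - x)) = 1" using xw by (simp add: norm_sgn)
  have xd: "norm (z - x) \<le> R/2" "norm (x - z) \<le> R/2" "norm (y - x) \<le> R/2"
    using yz by (auto simp: dist_norm norm_minus_commute)
  have yzd: "norm (y - z) \<le> R"
    using norm_triangle_ineq4[of "y - x" "z - x"] xd by simp
  have "line_dev (y - z) (w - x) \<le> 2 * \<eta>" if "y \<noteq> z"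
  proof (cases "z = x")
    case True
    then show ?thesis using flat[of x y w] that xw xd yz \<eta> R by auto
  next
    case False
    have "line_dev (y - z) (x - z) \<le> \<eta>" using flat[of z y x] that xw xd yz yzd False R by auto
    moreover have "line_dev (z - x) (w - x) \<le> \<eta>" using flat[of x z w] that xw xd yz False R by auto
    ultimately show ?thesis
      using line_dev_triangle[of "y - z" "w - x" "x - z"] line_dev_minus_left[of "z - x" "w - x"] by simp
  qed
  moreover have "line_dev (y - z) (sgn (w - x)) = line_dev (y - z) (w - x)"
    using n by (simp add: line_dev_def sgn_div_norm[of "sgn (w - x)"])
  ultimately show "norm (y - z - ((y - z) \<bullet> sgn (w - x)) *\<^sub>R sgn (w - x)) \<le> 2 * \<eta> * norm (y - z)"
    using orthogonal_component_le_line_dev[OF n, of "y - z"] mult_right_mono[of _ _ "norm (y - z)"]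
    by (cases "y = z") (auto intro: order_trans)
qed

section \<open>Monotone arcs\<close>

text \<open>A value strictly between those at the endpoints and at the midpoint is taken on both
  sides of the midpoint. This is how a nearly straight piece is prevented from containing the whole
  closed curve.\<close>

lemma not_inj_on_if_equal_ends:
  fixes f :: "real \<Rightarrow> real"
  assumes "a < b" "continuous_on {a..b} f" "f a = f b"
  shows "\<not> inj_on f {a..<b}"
proof
  assume inj: "inj_on f {a..<b}"
  define m where "m = (a + b) / 2"
  have m: "a < m" "m < b" using assms by (auto simp: m_def)
  then have fm: "f m \<noteq> f a" using inj by (auto dest: inj_onD)
  define c where "c = (f a + f m) / 2"
  have cont: "continuous_on {a..m} f" "continuous_on {m..b} f"
    using m by (auto intro: continuous_on_subset[OF assms(2)])
  have c: "f a \<le> c \<and> c \<le> f m \<or> f m \<le> c \<and> c \<le> f a"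
    by (cases "f a \<le> f m") (auto simp: c_def)
  then have "\<exists>s\<ge>a. s \<le> m \<and> f s = c"
    using IVT'[of f a c m, OF _ _ _ cont(1)] IVT2'[of f m c a, OF _ _ _ cont(1)] m by (meson less_imp_le)
  moreover have "\<exists>t\<ge>m. t \<le> b \<and> f t = c"
    using c IVT2'[of f b c m, OF _ _ _ cont(2)] IVT'[of f m c b, OF _ _ _ cont(2)] m
    unfolding assms(3) by (meson less_imp_le)
  ultimately obtain s t where st: "a \<le> s" "s \<le> m" "m \<le> t" "t \<le> b" "f s = c" "f t = c" by blast
  have "c \<noteq> f a" "c \<noteq> f m" using fm by (auto simp: c_def field_simps)
  with st assms(3) have "s < m" "t < b" by (auto simp: less_le)
  then show False using inj st m by (auto dest: inj_onD)
qed

lemma injective_arclength_param_eqD: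
  assumes "injective_arclength_param L \<Gamma>" "L > 0" "\<Gamma> s = \<Gamma> t"
  shows "\<exists>k::int. s = t + of_int k * L"
proof -
  have arc: "arclength_param L \<Gamma>" and inj: "inj_on \<Gamma> {0..<L}"
    using assms by (auto simp: injective_arclength_param_def)
  obtain i where i: "s + of_int i * L \<in> {0..<0+L}" "\<Gamma> (s + of_int i * L) = \<Gamma> s"
    by (rule arclength_param_reduce[OF arc assms(2)])
  obtain j where j: "t + of_int j * L \<in> {0..<0+L}" "\<Gamma> (t + of_int j * L) = \<Gamma> t"
    by (rule arclength_param_reduce[OF arc assms(2)])
  have "s + of_int i * L = t + of_int j * L"
    using i j assms(3) by (intro inj_onD[OF inj]) auto
  then have "s = t + of_int (j - i) * L" by (simp add: algebra_simps)
  then show ?thesis ..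
qed

lemma injective_arclength_param_inj_on:
  assumes "injective_arclength_param L \<Gamma>" "L > 0"
  shows "inj_on \<Gamma> {a..<a+L}"
proof (rule inj_onI)
  fix s t assume st: "s \<in> {a..<a+L}" "t \<in> {a..<a+L}" "\<Gamma> s = \<Gamma> t"
  then obtain k :: int where k: "s = t + of_int k * L" using injective_arclength_param_eqD[OF assms] by blast
  have "\<bar>s - t\<bar> < L" using st by auto
  then have "\<bar>of_int k\<bar> * L < 1 * L" using k assms(2) by (simp add: abs_mult)
  then have "\<bar>k\<bar> < 1" using assms(2) by (simp only: mult_less_cancel_right) auto
  then show "s = t" using k by simp
qed

text \<open>The hypothesis measures progress along \<open>v\<close> against the chord, the
  conclusion against the parameter. At a point of unit speed both agree to first order, so the
  derivative has component at least \<open>1 - \<theta>\<close> along \<open>v\<close>, and this is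
  integrated.\<close>

lemma arclength_param_inner_ge:
  fixes \<Gamma> :: "real \<Rightarrow> 'a::euclidean_space"
  assumes arc: "arclength_param L \<Gamma>" and "a \<le> b" and \<theta>: "0 \<le> \<theta>" "\<theta> \<le> 1"
    and mono: "\<And>x y. a \<le> x \<Longrightarrow> x < y \<Longrightarrow> y \<le> b \<Longrightarrow> (1 - \<theta>) * norm (\<Gamma> y - \<Gamma> x) \<le> (\<Gamma> y - \<Gamma> x) \<bullet> v"
    and v: "norm v = 1"
  shows "(1 - \<theta>) * (b - a) \<le> (\<Gamma> b - \<Gamma> a) \<bullet> v"
proof -
  \<comment> \<open>The derivative is tested with chords to the right that end in the interval;
    hence the endpoint \<open>b\<close> is removed as a null set.\<close>
  have "AE x in lborel. a \<le> x \<longrightarrow> x \<le> b \<longrightarrow>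
      (\<exists>D. (\<Gamma> has_vector_derivative D) (at x) \<and> D \<bullet> (- v) \<le> - (1 - \<theta>))"
    using arclength_param_AE[OF arc] AE_lborel_singleton[of b]
  proof (eventually_elim, intro impI)
    fix x assume "\<exists>D. (\<Gamma> has_vector_derivative D) (at x) \<and> norm D = 1" "x \<noteq> b" and x: "a \<le> x" "x \<le> b"
    then obtain D where D: "(\<Gamma> has_vector_derivative D) (at x)" "norm D = 1" and xb: "x < b" by auto
    have "1 - \<theta> \<le> D \<bullet> v + \<epsilon>" if \<epsilon>: "\<epsilon> > 0" for \<epsilon>
    proof -
      have "(\<Gamma> has_derivative (\<lambda>h. h *\<^sub>R D)) (at x)" using D(1) by (simp add: has_vector_derivative_def)
      moreover have "\<epsilon> / 2 > 0" using \<epsilon> by simp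
      ultimately obtain d where d: "d > 0"
        "\<And>y. \<bar>y - x\<bar> < d \<Longrightarrow> norm (\<Gamma> y - \<Gamma> x - (y - x) *\<^sub>R D) \<le> (\<epsilon>/2) * \<bar>y - x\<bar>"
        unfolding has_derivative_at_alt real_norm_def by blast
      define y where "y = min b (x + d/2)"
      have y: "x < y" "y \<le> b" "\<bar>y - x\<bar> < d" using d(1) xb by (auto simp: y_def)
      define w where "w = \<Gamma> y - \<Gamma> x - (y - x) *\<^sub>R D"
      have w: "norm w \<le> (\<epsilon>/2) * (y - x)" using d(2)[OF y(3)] y by (simp add: w_def)
      have k: "\<Gamma> y - \<Gamma> x = (y - x) *\<^sub>R D + w" by (simp add: w_def)
      have "(y - x) - norm w \<le> norm (\<Gamma> y - \<Gamma> x)"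
        unfolding k using norm_diff_ineq[of "(y - x) *\<^sub>R D" w] D(2) y by simp
      then have "(1 - \<theta>) * ((y - x) - norm w) \<le> (1 - \<theta>) * norm (\<Gamma> y - \<Gamma> x)"
        using \<theta> by (intro mult_left_mono) auto
      also have "\<dots> \<le> (\<Gamma> y - \<Gamma> x) \<bullet> v" using mono x y by auto
      also have "\<dots> \<le> (y - x) * (D \<bullet> v) + norm w"
        unfolding k using norm_cauchy_schwarz[of w v] v by (simp add: inner_add_left)
      finally have "(1 - \<theta>) * (y - x) \<le> (y - x) * (D \<bullet> v) + norm w + (1 - \<theta>) * norm w"
        by (simp add: algebra_simps)
      also have "\<dots> \<le> (y - x) * (D \<bullet> v) + 2 * norm w"
        using \<theta> mult_right_mono[of "1 - \<theta>" 1 "norm w"] by simp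
      also have "\<dots> \<le> (D \<bullet> v + \<epsilon>) * (y - x)" using w by (simp add: algebra_simps)
      finally show ?thesis using y by simp
    qed
    then have "1 - \<theta> \<le> D \<bullet> v" by (rule field_le_epsilon)
    then show "\<exists>D. (\<Gamma> has_vector_derivative D) (at x) \<and> D \<bullet> (- v) \<le> - (1 - \<theta>)"
      using D(1) by (intro exI[of _ D]) auto
  qed
  from lipschitz_AE_inner_deriv_le[OF \<open>a \<le> b\<close> arclength_param_lipschitz[OF arc] this]
  show ?thesis by (simp add: algebra_simps)
qed

text \<open>The cone condition lets the height along \<open>v\<close> determine the point, so on an
  arc where the curve is injective the height is injective, hence monotone. The axis in the
  conclusion may be \<open>- v\<close>, to make it increasing.\<close>

lemma nearly_straight_imp_monotone_arc:
  fixes \<Gamma> :: "real \<Rightarrow> 'a::euclidean_space"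
  assumes inj: "injective_arclength_param L \<Gamma>" and L: "L > 0" and r: "r > 0" and \<theta>: "0 \<le> \<theta>" "\<theta> < 1"
    and v: "norm v = 1" and ns: "nearly_straight \<theta> v (range \<Gamma> \<inter> cball (\<Gamma> s) r)"
  shows "\<exists>v. norm v = 1 \<and> nearly_straight \<theta> v (range \<Gamma> \<inter> cball (\<Gamma> s) r) \<and>
    (\<forall>t t'. s - r \<le> t \<longrightarrow> t \<le> t' \<longrightarrow> t' \<le> s + r \<longrightarrow> (1 - \<theta>) * (t' - t) \<le> (\<Gamma> t' - \<Gamma> t) \<bullet> v)"
proof -
  have arc: "arclength_param L \<Gamma>" using inj by (simp add: injective_arclength_param_def)
  define f where "f t = \<Gamma> t \<bullet> v" for t
  have contf: "continuous_on T f" for T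
    unfolding f_def
    using lipschitz_on_continuous_on[OF lipschitz_on_subset[OF arclength_param_lipschitz[OF arc] subset_UNIV]]
    by (intro continuous_intros)
  have ball: "\<Gamma> t \<in> range \<Gamma> \<inter> cball (\<Gamma> s) r" if "t \<in> {s-r..s+r}" for t
    using arclength_param_norm_le[OF arc, of t s] that by (auto simp: dist_norm norm_minus_commute)
  have feq: "\<Gamma> t = \<Gamma> t'" if "t \<in> {s-r..s+r}" "t' \<in> {s-r..s+r}" "f t = f t'" for t t'
  proof -
    have "(1 - \<theta>) * norm (\<Gamma> t - \<Gamma> t') \<le> 0"
      using nearly_straight_norm_le[OF ns v ball[OF that(1)] ball[OF that(2)]] that(3)
      by (simp add: f_def inner_diff_left)
    then show ?thesis using \<theta> by (simp add: mult_le_0_iff)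
  qed
  \<comment> \<open>Otherwise a full period would fit into the arc, and the height would be an
    injective continuous function on a circle.\<close>
  have "2 * r < L"
  proof (rule ccontr)
    assume "\<not> 2 * r < L"
    then have sub: "{s-r..s-r+L} \<subseteq> {s-r..s+r}" by auto
    have "f (s - r) = f (s - r + L)" using arclength_param_periodic[OF arc, of "s - r" 1] by (simp add: f_def)
    then have "\<not> inj_on f {s-r..<s-r+L}" using not_inj_on_if_equal_ends[OF _ contf] L by simp
    moreover have "inj_on f {s-r..<s-r+L}"
    proof (rule inj_onI)
      fix t t' assume t: "t \<in> {s-r..<s-r+L}" "t' \<in> {s-r..<s-r+L}" "f t = f t'"
      then have "\<Gamma> t = \<Gamma> t'" using sub by (intro feq) auto
      then show "t = t'" using inj_onD[OF injective_arclength_param_inj_on[OF inj L] _ t(1,2)] by blast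
    qed
    ultimately show False ..
  qed
  then have "{s-r..s+r} \<subseteq> {s-r..<s-r+L}" by auto
  then have inj\<Gamma>: "inj_on \<Gamma> {s-r..s+r}"
    by (rule inj_on_subset[OF injective_arclength_param_inj_on[OF inj L]])
  have "inj_on f {s-r..s+r}"
    by (rule inj_onI, rule inj_onD[OF inj\<Gamma>], rule feq)
  then have mono: "strict_mono_on {s-r..s+r} f \<or> strict_antimono_on {s-r..s+r} f"
    using injective_eq_monotone_map[OF _ contf] by (simp add: is_interval_cc)
  have main: ?thesis
    if w: "norm w = 1" "nearly_straight \<theta> w (range \<Gamma> \<inter> cball (\<Gamma> s) r)"
      and up: "\<And>t t'. s - r \<le> t \<Longrightarrow> t < t' \<Longrightarrow> t' \<le> s + r \<Longrightarrow> 0 < (\<Gamma> t' - \<Gamma> t) \<bullet> w" for w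
  proof (intro exI[of _ w] conjI allI impI w)
    fix t t' assume t: "s - r \<le> t" "t \<le> t'" "t' \<le> s + r"
    show "(1 - \<theta>) * (t' - t) \<le> (\<Gamma> t' - \<Gamma> t) \<bullet> w"
    proof (rule arclength_param_inner_ge[OF arc t(2) \<theta>(1) _ _ w(1)])
      fix x y assume "t \<le> x" "x < y" "y \<le> t'"
      then show "(1 - \<theta>) * norm (\<Gamma> y - \<Gamma> x) \<le> (\<Gamma> y - \<Gamma> x) \<bullet> w"
        using nearly_straight_norm_le[OF w(2,1) ball[of y] ball[of x]] up[of x y] t by simp
    qed (use \<theta> in auto)
  qed
  from mono show ?thesis
  proof
    assume *: "strict_mono_on {s-r..s+r} f"
    show ?thesis
    proof (rule main[OF v ns])
      fix t t' assume "s - r \<le> t" "t < t'" "t' \<le> s + r"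
      then have "f t < f t'" by (intro strict_mono_onD[OF *]) auto
      then show "0 < (\<Gamma> t' - \<Gamma> t) \<bullet> v" by (simp add: f_def inner_diff_left)
    qed
  next
    assume *: "strict_antimono_on {s-r..s+r} f"
    show ?thesis
    proof (rule main[of "- v"])
      fix t t' assume "s - r \<le> t" "t < t'" "t' \<le> s + r"
      then have "f t' < f t" by (intro monotone_onD[OF *]) auto
      then show "0 < (\<Gamma> t' - \<Gamma> t) \<bullet> - v" by (simp add: f_def inner_diff_left)
    qed (use v ns in \<open>simp_all add: nearly_straight_minus\<close>)
  qed
qed

section \<open>Nearby locally straight curves\<close>

text \<open>The cone condition concerns the whole image in the ball, so it also controls other
  strands; the monotonicity concerns the arc through \<open>s\<close> and is stated in arc
  length.\<close>

definition locally_straight :: "real \<Rightarrow> real \<Rightarrow> (real \<Rightarrow> 'a::euclidean_space) \<Rightarrow> bool" where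
  "locally_straight \<theta> r \<Gamma> \<longleftrightarrow> (\<forall>s. \<exists>v. norm v = 1 \<and> nearly_straight \<theta> v (range \<Gamma> \<inter> cball (\<Gamma> s) r) \<and>
    (\<forall>t t'. s - r \<le> t \<longrightarrow> t \<le> t' \<longrightarrow> t' \<le> s + r \<longrightarrow> (1 - \<theta>) * (t' - t) \<le> (\<Gamma> t' - \<Gamma> t) \<bullet> v))"

text \<open>The transverse part of the chord and its shortfall along the axis contribute
  \<open>\<theta> * l\<close> each.\<close>

lemma nearly_straight_chord_near:
  assumes ns: "nearly_straight \<theta> v S" and v: "norm v = 1" and xy: "x \<in> S" "y \<in> S"
    and len: "norm (y - x) \<le> l" "(1 - \<theta>) * l \<le> (y - x) \<bullet> v" and \<theta>: "\<theta> \<ge> 0"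
  shows "norm ((y - x) - l *\<^sub>R v) \<le> 2 * \<theta> * l"
proof -
  have "(y - x) \<bullet> v \<le> l" using norm_cauchy_schwarz[of "y - x" v] v len(1) by simp
  then have "norm (((y - x) \<bullet> v - l) *\<^sub>R v) \<le> \<theta> * l"
    using v len(2) by (simp only: norm_scaleR left_diff_distrib) simp
  moreover have "norm ((y - x) - ((y - x) \<bullet> v) *\<^sub>R v) \<le> \<theta> * l"
    using nearly_straightD[OF ns xy(2,1)] mult_left_mono[OF len(1) \<theta>] by linarith
  moreover have eq: "(y - x) - l *\<^sub>R v = ((y - x) - ((y - x) \<bullet> v) *\<^sub>R v) + ((y - x) \<bullet> v - l) *\<^sub>R v"
    by (simp add: algebra_simps)
  ultimately show ?thesis
    unfolding eq
    using norm_triangle_ineq[of "(y - x) - ((y - x) \<bullet> v) *\<^sub>R v" "((y - x) \<bullet> v - l) *\<^sub>R v"] by linarith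
qed

lemma inner_ge_perturb:
  fixes k u w :: "'a::real_inner"
  assumes "norm (u - w) \<le> \<kappa>"
  shows "k \<bullet> w - \<kappa> * norm k \<le> k \<bullet> u"
proof -
  have "k \<bullet> (w - u) \<le> norm k * norm (w - u)" by (rule norm_cauchy_schwarz)
  also have "\<dots> \<le> norm k * \<kappa>" using assms by (intro mult_left_mono) (auto simp: norm_minus_commute)
  finally show ?thesis by (simp add: inner_diff_right mult.commute)
qed

text \<open>\<open>r\<close> is the scale of straightness. The two halves of the Hausdorff bound
  have separate tasks: \<open>near12\<close> gives every point of the first curve a counterpart,
  \<open>near21\<close> makes the counterparts exhaust the second curve.\<close>

locale close_curves =
  fixes L\<^sub>1 L\<^sub>2 r :: real and \<Gamma>\<^sub>1 \<Gamma>\<^sub>2 :: "real \<Rightarrow> 'a::euclidean_space"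
  assumes L: "L\<^sub>1 > 0" and r: "r > 0"
    and inj: "injective_arclength_param L\<^sub>1 \<Gamma>\<^sub>1" and arc2: "arclength_param L\<^sub>2 \<Gamma>\<^sub>2"
    and straight1: "locally_straight (1/200) r \<Gamma>\<^sub>1" and straight2: "locally_straight (1/200) r \<Gamma>\<^sub>2"
    and near12: "\<And>s. \<exists>u. norm (\<Gamma>\<^sub>2 u - \<Gamma>\<^sub>1 s) \<le> r / 1000"
    and near21: "\<And>u. \<exists>s. norm (\<Gamma>\<^sub>2 u - \<Gamma>\<^sub>1 s) \<le> r / 1000"
begin

section \<open>Secant directions and the local axes of the two curves\<close>

lemma arc1: "arclength_param L\<^sub>1 \<Gamma>\<^sub>1"
  using inj by (simp add: injective_arclength_param_def)

lemmas norm1 = arclength_param_norm_le[OF arc1] and norm2 = arclength_param_norm_le[OF arc2]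

lemma continuous1: "continuous_on T \<Gamma>\<^sub>1" and continuous2: "continuous_on T \<Gamma>\<^sub>2"
  by (rule lipschitz_on_continuous_on[OF lipschitz_on_subset[OF arclength_param_lipschitz subset_UNIV]],
      rule arc1 arc2)+

text \<open>Dividing by arc length rather than by the length of the chord keeps
  \<open>\<tau>\<close> linear in the curve. It is not a unit vector, but it is within 1/100 of
  one.\<close>

definition \<tau> :: "real \<Rightarrow> 'a" where
  "\<tau> s = (1 / (2 * r)) *\<^sub>R (\<Gamma>\<^sub>1 (s + r) - \<Gamma>\<^sub>1 (s - r))"

lemma norm_\<tau>: "norm (\<tau> s) \<le> 1"
  using norm1[of "s + r" "s - r"] r by (simp add: \<tau>_def)

lemma \<tau>_lipschitz: "norm (\<tau> s - \<tau> t) \<le> \<bar>s - t\<bar> / r"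
proof -
  have "\<tau> s - \<tau> t = (1 / (2 * r)) *\<^sub>R ((\<Gamma>\<^sub>1 (s + r) - \<Gamma>\<^sub>1 (t + r)) - (\<Gamma>\<^sub>1 (s - r) - \<Gamma>\<^sub>1 (t - r)))"
    by (simp add: \<tau>_def algebra_simps)
  then have "norm (\<tau> s - \<tau> t) = norm ((\<Gamma>\<^sub>1 (s + r) - \<Gamma>\<^sub>1 (t + r)) - (\<Gamma>\<^sub>1 (s - r) - \<Gamma>\<^sub>1 (t - r))) / (2 * r)"
    using r by simp
  also have "\<dots> \<le> (2 * \<bar>s - t\<bar>) / (2 * r)"
    using norm1[of "s + r" "t + r"] norm1[of "s - r" "t - r"] r
      norm_triangle_ineq4[of "\<Gamma>\<^sub>1 (s + r) - \<Gamma>\<^sub>1 (t + r)" "\<Gamma>\<^sub>1 (s - r) - \<Gamma>\<^sub>1 (t - r)"]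
    by (intro divide_right_mono) auto
  finally show ?thesis by simp
qed

text \<open>By injectivity the secant depends on the point and not on the parameter chosen for it.
  This makes the displacement well defined on the image.\<close>

lemma \<tau>_eq:
  assumes "\<Gamma>\<^sub>1 s = \<Gamma>\<^sub>1 t"
  shows "\<tau> s = \<tau> t"
proof -
  obtain k :: int where k: "s = t + of_int k * L\<^sub>1"
    using injective_arclength_param_eqD[OF inj L assms] by blast
  have "\<Gamma>\<^sub>1 (s + h) = \<Gamma>\<^sub>1 (t + h)" for h
    using arclength_param_periodic[OF arc1, of "t + h" k] by (simp add: k add_ac)
  from this[of r] this[of "- r"] show ?thesis by (simp add: \<tau>_def)
qed

text \<open>The axis \<open>v\<close> carries the straightness but is chosen separately for each
  \<open>s\<close>; \<open>\<tau>\<close> varies in a Lipschitz way but carries no cone condition.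
  The last conjunct allows one to be traded for the other.\<close>

definition tangent_dir :: "real \<Rightarrow> 'a \<Rightarrow> bool" where
  "tangent_dir s v \<longleftrightarrow> norm v = 1 \<and> nearly_straight (1/200) v (range \<Gamma>\<^sub>1 \<inter> cball (\<Gamma>\<^sub>1 s) r) \<and>
    (\<forall>t t'. s - r \<le> t \<longrightarrow> t \<le> t' \<longrightarrow> t' \<le> s + r \<longrightarrow> (1 - 1/200) * (t' - t) \<le> (\<Gamma>\<^sub>1 t' - \<Gamma>\<^sub>1 t) \<bullet> v) \<and>
    norm (\<tau> s - v) \<le> 1/100"

lemma tangent_dirD:
  assumes "tangent_dir s v"
  shows "norm v = 1" "nearly_straight (1/200) v (range \<Gamma>\<^sub>1 \<inter> cball (\<Gamma>\<^sub>1 s) r)"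
    "s - r \<le> t \<Longrightarrow> t \<le> t' \<Longrightarrow> t' \<le> s + r \<Longrightarrow> 199/200 * (t' - t) \<le> (\<Gamma>\<^sub>1 t' - \<Gamma>\<^sub>1 t) \<bullet> v"
    "norm (\<tau> s - v) \<le> 1/100"
proof -
  have "1 - 1/200 = (199/200 :: real)" by simp
  note td = assms[unfolded tangent_dir_def this]
  show "norm v = 1" "nearly_straight (1/200) v (range \<Gamma>\<^sub>1 \<inter> cball (\<Gamma>\<^sub>1 s) r)"
    "s - r \<le> t \<Longrightarrow> t \<le> t' \<Longrightarrow> t' \<le> s + r \<Longrightarrow> 199/200 * (t' - t) \<le> (\<Gamma>\<^sub>1 t' - \<Gamma>\<^sub>1 t) \<bullet> v"
    "norm (\<tau> s - v) \<le> 1/100"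
    using td by blast+
qed

lemma ex_tangent_dir: "\<exists>v. tangent_dir s v"
proof -
  obtain v where v: "norm v = 1" "nearly_straight (1/200) v (range \<Gamma>\<^sub>1 \<inter> cball (\<Gamma>\<^sub>1 s) r)"
    and mono0: "\<forall>t t'. s - r \<le> t \<longrightarrow> t \<le> t' \<longrightarrow> t' \<le> s + r \<longrightarrow> (1 - 1/200) * (t' - t) \<le> (\<Gamma>\<^sub>1 t' - \<Gamma>\<^sub>1 t) \<bullet> v"
    using straight1[unfolded locally_straight_def, THEN spec, of s] by (elim exE conjE)
  note mono = mono0[rule_format]
  define k where "k = \<Gamma>\<^sub>1 (s + r) - \<Gamma>\<^sub>1 (s - r)"
  \<comment> \<open>Dividing this by \<open>2 * r\<close> gives the 1/100.\<close>
  have "norm (k - (2 * r) *\<^sub>R v) \<le> 2 * (1/200) * (2 * r)"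
    unfolding k_def
  proof (rule nearly_straight_chord_near[OF v(2,1)])
    show "\<Gamma>\<^sub>1 (s - r) \<in> range \<Gamma>\<^sub>1 \<inter> cball (\<Gamma>\<^sub>1 s) r" "\<Gamma>\<^sub>1 (s + r) \<in> range \<Gamma>\<^sub>1 \<inter> cball (\<Gamma>\<^sub>1 s) r"
      using norm1[of s "s - r"] norm1[of s "s + r"] r by (auto simp: dist_norm)
    show "norm (\<Gamma>\<^sub>1 (s + r) - \<Gamma>\<^sub>1 (s - r)) \<le> 2 * r" using norm1[of "s + r" "s - r"] r by simp
    show "(1 - 1/200) * (2 * r) \<le> (\<Gamma>\<^sub>1 (s + r) - \<Gamma>\<^sub>1 (s - r)) \<bullet> v" using mono[of "s - r" "s + r"] r by simp
  qed simp
  moreover have "\<tau> s - v = (1 / (2 * r)) *\<^sub>R (k - (2 * r) *\<^sub>R v)"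
    using r by (simp add: \<tau>_def k_def algebra_simps)
  then have "norm (\<tau> s - v) = norm (k - (2 * r) *\<^sub>R v) / (2 * r)"
    using r by (simp only: norm_scaleR) simp
  then have "norm (\<tau> s - v) * (2 * r) = norm (k - (2 * r) *\<^sub>R v)" using r by simp
  ultimately have "norm (\<tau> s - v) * (2 * r) \<le> 1/100 * (2 * r)" by simp
  then have "norm (\<tau> s - v) \<le> 1/100" using r by (simp only: mult_le_cancel_right)
  then show ?thesis unfolding tangent_dir_def using v mono0 by blast
qed

text \<open>A chord of the first curve of length about \<open>r/2\<close> is shadowed by a chord of
  the second with nearby endpoints, and both axes are nearly parallel to the shadow. The sign
  \<sigma> allows for opposite orientations of the axes.\<close>

lemma ex_sign_direction_near:
  assumes td: "tangent_dir s v"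
    and u: "norm (\<Gamma>\<^sub>2 u - \<Gamma>\<^sub>1 s) \<le> r / 1000"
    and w: "norm w = 1" "nearly_straight (1/200) w (range \<Gamma>\<^sub>2 \<inter> cball (\<Gamma>\<^sub>2 u) r)"
  shows "\<exists>\<sigma>. \<bar>\<sigma>\<bar> = 1 \<and> norm (v - \<sigma> *\<^sub>R w) \<le> 1/25"
proof -
  note v = tangent_dirD[OF td] and mono = tangent_dirD(3)[OF td]
  define m where "m = \<Gamma>\<^sub>1 (s + r/2) - \<Gamma>\<^sub>1 s"
  have "norm (m - (r/2) *\<^sub>R v) \<le> 2 * (1/200) * (r/2)"
    unfolding m_def
  proof (rule nearly_straight_chord_near[OF v(2,1)])
    show "\<Gamma>\<^sub>1 s \<in> range \<Gamma>\<^sub>1 \<inter> cball (\<Gamma>\<^sub>1 s) r" "\<Gamma>\<^sub>1 (s + r/2) \<in> range \<Gamma>\<^sub>1 \<inter> cball (\<Gamma>\<^sub>1 s) r"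
      using norm1[of s "s + r/2"] r by (auto simp: dist_norm)
    show "norm (\<Gamma>\<^sub>1 (s + r/2) - \<Gamma>\<^sub>1 s) \<le> r/2" using norm1[of "s + r/2" s] r by simp
    show "(1 - 1/200) * (r/2) \<le> (\<Gamma>\<^sub>1 (s + r/2) - \<Gamma>\<^sub>1 s) \<bullet> v" using mono[of s "s + r/2"] r by simp
  qed simp
  then have m: "norm (m - (r/2) *\<^sub>R v) \<le> r / 200" by simp
  obtain u' where u': "norm (\<Gamma>\<^sub>2 u' - \<Gamma>\<^sub>1 (s + r/2)) \<le> r / 1000" using near12 by blast
  define g where "g = \<Gamma>\<^sub>2 u' - \<Gamma>\<^sub>2 u"
  have "g - (r/2) *\<^sub>R v = (m - (r/2) *\<^sub>R v) + ((\<Gamma>\<^sub>2 u' - \<Gamma>\<^sub>1 (s + r/2)) - (\<Gamma>\<^sub>2 u - \<Gamma>\<^sub>1 s))"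
    by (simp add: g_def m_def)
  then have "norm (g - (r/2) *\<^sub>R v) \<le> norm (m - (r/2) *\<^sub>R v) +
      (norm (\<Gamma>\<^sub>2 u' - \<Gamma>\<^sub>1 (s + r/2)) + norm (\<Gamma>\<^sub>2 u - \<Gamma>\<^sub>1 s))"
    by (metis (no_types) add_left_mono norm_triangle_ineq norm_triangle_ineq4 order_trans)
  then have g1: "norm (g - (r/2) *\<^sub>R v) \<le> 7 * r / 1000" using m u u' by linarith
  then have g2: "norm g \<le> 51/100 * r"
    using norm_triangle_ineq[of "g - (r/2) *\<^sub>R v" "(r/2) *\<^sub>R v"] v r by simp
  have "norm (g - (g \<bullet> w) *\<^sub>R w) \<le> (1/200) * norm g"
    unfolding g_def using g2 r
    by (intro nearly_straightD[OF w(2)]) (auto simp: g_def dist_norm norm_minus_commute)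
  then have g3: "norm (g - (g \<bullet> w) *\<^sub>R w) \<le> 51/20000 * r" using g2 by simp
  define c where "c = (g \<bullet> w) * 2 / r"
  have "v - c *\<^sub>R w = (2 / r) *\<^sub>R ((g - (g \<bullet> w) *\<^sub>R w) - (g - (r/2) *\<^sub>R v))"
    using r by (simp add: c_def algebra_simps)
  then have "norm (v - c *\<^sub>R w) = (2 / r) * norm ((g - (g \<bullet> w) *\<^sub>R w) - (g - (r/2) *\<^sub>R v))"
    using r by simp
  also have "\<dots> \<le> (2 / r) * (r / 100)"
  proof (rule mult_left_mono)
    show "norm ((g - (g \<bullet> w) *\<^sub>R w) - (g - (r/2) *\<^sub>R v)) \<le> r / 100"
      using norm_triangle_ineq4[of "g - (g \<bullet> w) *\<^sub>R w" "g - (r/2) *\<^sub>R v"] g1 g3 r by linarith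
  qed (use r in auto)
  finally have "norm (v - c *\<^sub>R w) \<le> 1/50 * norm v" using r v by simp
  moreover have "v \<noteq> 0" "w \<noteq> 0" using v w by auto
  ultimately have "line_dev v w \<le> 2 * (1/50)" by (intro line_dev_le)
  moreover have "sgn v = v" "sgn w = w" using v w by (simp_all add: sgn_div_norm)
  ultimately have "norm (v - 1 *\<^sub>R w) \<le> 1/25 \<or> norm (v - (- 1) *\<^sub>R w) \<le> 1/25"
    by (auto simp: line_dev_def min_def split: if_splits)
  then show ?thesis by (metis abs_minus abs_one)
qed

text \<open>The cone of the second curve around its own axis \<open>w\<close> is widened to one
  around \<open>v\<close>; the tilt 1/25 between the axes enlarges the opening from 1/200 to less
  than 1/10.\<close>

lemma curve2_nearly_straight_and_transversal:
  assumes td: "tangent_dir s v"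
  shows "nearly_straight (1/10) v (range \<Gamma>\<^sub>2 \<inter> cball (\<Gamma>\<^sub>1 s) (r/2))"
    and "\<exists>y\<in>range \<Gamma>\<^sub>2. norm (y - \<Gamma>\<^sub>1 s) \<le> 3 * r / 1000 \<and> (y - \<Gamma>\<^sub>1 s) \<bullet> \<tau> s = 0"
proof -
  note v = tangent_dirD[OF td] and v\<tau> = tangent_dirD(4)[OF td]
  obtain u where u: "norm (\<Gamma>\<^sub>2 u - \<Gamma>\<^sub>1 s) \<le> r / 1000" using near12 by blast
  obtain w where w: "norm w = 1" "nearly_straight (1/200) w (range \<Gamma>\<^sub>2 \<inter> cball (\<Gamma>\<^sub>2 u) r)"
    and "\<forall>t t'. u - r \<le> t \<longrightarrow> t \<le> t' \<longrightarrow> t' \<le> u + r \<longrightarrow> (1 - 1/200) * (t' - t) \<le> (\<Gamma>\<^sub>2 t' - \<Gamma>\<^sub>2 t) \<bullet> w"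
    using straight2[unfolded locally_straight_def, THEN spec, of u] by (elim exE conjE)
  note mono2 = this(3)[rule_format]
  obtain \<sigma> where \<sigma>: "\<bar>\<sigma>\<bar> = 1" "norm (v - \<sigma> *\<^sub>R w) \<le> 1/25"
    using ex_sign_direction_near[OF td u w] by blast
  have \<sigma>2: "\<sigma> * \<sigma> = 1" using \<sigma>(1) by (metis abs_mult_self_eq mult_1)
  have wv: "norm (w - \<sigma> *\<^sub>R v) \<le> 1/25"
  proof -
    have "w - \<sigma> *\<^sub>R v = - \<sigma> *\<^sub>R (v - \<sigma> *\<^sub>R w)" using \<sigma>2 by (simp add: scaleR_diff_right)
    then show ?thesis using \<sigma> by simp
  qed
  show "nearly_straight (1/10) v (range \<Gamma>\<^sub>2 \<inter> cball (\<Gamma>\<^sub>1 s) (r/2))"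
    unfolding nearly_straight_def
  proof (intro ballI)
    fix y z assume yz: "y \<in> range \<Gamma>\<^sub>2 \<inter> cball (\<Gamma>\<^sub>1 s) (r/2)" "z \<in> range \<Gamma>\<^sub>2 \<inter> cball (\<Gamma>\<^sub>1 s) (r/2)"
    have in_ball: "x \<in> range \<Gamma>\<^sub>2 \<inter> cball (\<Gamma>\<^sub>2 u) r" if "x \<in> range \<Gamma>\<^sub>2 \<inter> cball (\<Gamma>\<^sub>1 s) (r/2)" for x
      using that u r dist_triangle[of "\<Gamma>\<^sub>2 u" x "\<Gamma>\<^sub>1 s"] by (auto simp: dist_norm)
    define k where "k = y - z"
    have 1: "norm (k - (k \<bullet> w) *\<^sub>R w) \<le> 1/200 * norm k"
      unfolding k_def by (rule nearly_straightD[OF w(2) in_ball[OF yz(1)] in_ball[OF yz(2)]])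
    have "\<bar>k \<bullet> w\<bar> \<le> norm k" using Cauchy_Schwarz_ineq2[of k w] w by simp
    then have 2: "norm ((k \<bullet> w) *\<^sub>R (w - \<sigma> *\<^sub>R v)) \<le> norm k * (1/25)"
      using wv by (simp only: norm_scaleR) (intro mult_mono, auto)
    have "k - ((k \<bullet> w) * \<sigma>) *\<^sub>R v = (k - (k \<bullet> w) *\<^sub>R w) + (k \<bullet> w) *\<^sub>R (w - \<sigma> *\<^sub>R v)"
      by (simp add: algebra_simps)
    then have "norm (k - ((k \<bullet> w) * \<sigma>) *\<^sub>R v) \<le> norm (k - (k \<bullet> w) *\<^sub>R w) + norm ((k \<bullet> w) *\<^sub>R (w - \<sigma> *\<^sub>R v))"
      by (metis norm_triangle_ineq)
    then have "norm (k - (k \<bullet> v) *\<^sub>R v) \<le> 1/10 * norm k"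
      using orthogonal_component_minimal[OF v(1), of k "(k \<bullet> w) * \<sigma>"] 1 2 norm_ge_zero[of k] by linarith
    then show "norm (y - z - ((y - z) \<bullet> v) *\<^sub>R v) \<le> 1/10 * norm (y - z)" by (simp add: k_def)
  qed
  \<comment> \<open>The signed height above the plane, oriented to grow with \<open>t\<close>. It is
    within \<open>r / 1000\<close> of 0 at \<open>u\<close> and gains at least that much over a step
    of \<open>2 * r / 1000\<close>, so it vanishes within one step of \<open>u\<close>; the step and
    the initial distance add up to \<open>3 * r / 1000\<close>.\<close>
  define h where "h t = \<sigma> * ((\<Gamma>\<^sub>2 t - \<Gamma>\<^sub>1 s) \<bullet> \<tau> s)" for t
  have conth: "continuous_on T h" for T unfolding h_def by (intro continuous_intros continuous2)
  have incr: "r / 1000 \<le> h t' - h t"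
    if "u - r \<le> t" "t \<le> t'" "t' \<le> u + r" "t' - t = 2 * r / 1000" for t t'
  proof -
    define k where "k = \<Gamma>\<^sub>2 t' - \<Gamma>\<^sub>2 t"
    have k: "norm k \<le> 2 * r / 1000" using norm2[of t' t] that by (simp add: k_def)
    have "norm (\<sigma> *\<^sub>R \<tau> s - w) = norm (\<sigma> *\<^sub>R (\<tau> s - \<sigma> *\<^sub>R w))" using \<sigma>2 by (simp add: scaleR_diff_right)
    also have "\<dots> = norm ((\<tau> s - v) + (v - \<sigma> *\<^sub>R w))" using \<sigma>(1) by simp
    also have "\<dots> \<le> 1/20" using norm_triangle_ineq[of "\<tau> s - v" "v - \<sigma> *\<^sub>R w"] v\<tau> \<sigma> by linarith
    finally have "k \<bullet> w - 1/20 * norm k \<le> k \<bullet> (\<sigma> *\<^sub>R \<tau> s)" by (rule inner_ge_perturb)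
    moreover have "199/200 * (2 * r / 1000) \<le> k \<bullet> w" using mono2[of t t'] that by (simp add: k_def)
    moreover have "h t' - h t = k \<bullet> (\<sigma> *\<^sub>R \<tau> s)"
      by (simp add: h_def k_def inner_diff_left algebra_simps)
    ultimately show ?thesis using k r by linarith
  qed
  have "\<bar>h u\<bar> \<le> norm (\<Gamma>\<^sub>2 u - \<Gamma>\<^sub>1 s) * norm (\<tau> s)"
    using Cauchy_Schwarz_ineq2 \<sigma>(1) by (simp add: h_def abs_mult)
  also have "\<dots> \<le> (r / 1000) * 1" using u norm_\<tau> r by (intro mult_mono) auto
  finally have "\<bar>h u\<bar> \<le> r / 1000" by simp
  then have "h (u - 2 * r / 1000) \<le> 0" "0 \<le> h (u + 2 * r / 1000)"
    using incr[of "u - 2 * r / 1000" u] incr[of u "u + 2 * r / 1000"] r by auto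
  then obtain t where t: "u - 2 * r / 1000 \<le> t" "t \<le> u + 2 * r / 1000" "h t = 0"
    using IVT'[of h "u - 2 * r / 1000" 0 "u + 2 * r / 1000"] conth r by auto
  have "norm (\<Gamma>\<^sub>2 t - \<Gamma>\<^sub>1 s) \<le> norm (\<Gamma>\<^sub>2 t - \<Gamma>\<^sub>2 u) + norm (\<Gamma>\<^sub>2 u - \<Gamma>\<^sub>1 s)"
    using norm_triangle_ineq[of "\<Gamma>\<^sub>2 t - \<Gamma>\<^sub>2 u" "\<Gamma>\<^sub>2 u - \<Gamma>\<^sub>1 s"] by simp
  also have "norm (\<Gamma>\<^sub>2 t - \<Gamma>\<^sub>2 u) \<le> 2 * r / 1000" using norm2[of t u] t by linarith
  finally have "norm (\<Gamma>\<^sub>2 t - \<Gamma>\<^sub>1 s) \<le> 3 * r / 1000" using u by simp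
  moreover have "(\<Gamma>\<^sub>2 t - \<Gamma>\<^sub>1 s) \<bullet> \<tau> s = 0" using t(3) \<sigma>(1) by (auto simp: h_def)
  ultimately show "\<exists>y\<in>range \<Gamma>\<^sub>2. norm (y - \<Gamma>\<^sub>1 s) \<le> 3 * r / 1000 \<and> (y - \<Gamma>\<^sub>1 s) \<bullet> \<tau> s = 0" by blast
qed

text \<open>The difference of two such points is orthogonal to \<open>\<tau> s\<close>, but as a
  chord of the second curve it lies in a cone around \<open>v\<close>, which is almost
  \<open>\<tau> s\<close>.\<close>

lemma transversal_unique:
  assumes "y \<in> range \<Gamma>\<^sub>2" "norm (y - \<Gamma>\<^sub>1 s) \<le> 3 * r / 1000" "(y - \<Gamma>\<^sub>1 s) \<bullet> \<tau> s = 0"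
    and "z \<in> range \<Gamma>\<^sub>2" "norm (z - \<Gamma>\<^sub>1 s) \<le> 3 * r / 1000" "(z - \<Gamma>\<^sub>1 s) \<bullet> \<tau> s = 0"
  shows "y = z"
proof -
  obtain v where td: "tangent_dir s v" using ex_tangent_dir by blast
  note v = tangent_dirD[OF td]
  have "y \<in> range \<Gamma>\<^sub>2 \<inter> cball (\<Gamma>\<^sub>1 s) (r/2)" "z \<in> range \<Gamma>\<^sub>2 \<inter> cball (\<Gamma>\<^sub>1 s) (r/2)"
    using assms r by (auto simp: dist_norm norm_minus_commute)
  from nearly_straight_norm_le[OF curve2_nearly_straight_and_transversal(1)[OF td] v(1) this]
  have 1: "9/10 * norm (y - z) \<le> \<bar>(y - z) \<bullet> v\<bar>" by simp
  have "(y - z) \<bullet> \<tau> s = 0" using assms by (simp add: inner_diff_left)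
  then have "\<bar>(y - z) \<bullet> v\<bar> = \<bar>(y - z) \<bullet> (\<tau> s - v)\<bar>" by (simp add: inner_diff_right)
  also have "\<dots> \<le> norm (y - z) * norm (\<tau> s - v)" by (rule Cauchy_Schwarz_ineq2)
  also have "\<dots> \<le> norm (y - z) * (1/100)" using v(4) by (intro mult_left_mono) auto
  finally have "norm (y - z) \<le> 0" using 1 norm_ge_zero[of "y - z"] by linarith
  then show ?thesis by simp
qed

text \<open>The distance bound selects the local strand: the plane may well meet the second curve
  again farther away.\<close>

definition partner :: "real \<Rightarrow> 'a" where
  "partner s = (THE y. y \<in> range \<Gamma>\<^sub>2 \<and> norm (y - \<Gamma>\<^sub>1 s) \<le> 3 * r / 1000 \<and> (y - \<Gamma>\<^sub>1 s) \<bullet> \<tau> s = 0)"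

lemma partner_eqI:
  assumes "y \<in> range \<Gamma>\<^sub>2" "norm (y - \<Gamma>\<^sub>1 s) \<le> 3 * r / 1000" "(y - \<Gamma>\<^sub>1 s) \<bullet> \<tau> s = 0"
  shows "partner s = y"
  unfolding partner_def using assms transversal_unique by (intro the_equality) blast+

lemma partner: "partner s \<in> range \<Gamma>\<^sub>2" "norm (partner s - \<Gamma>\<^sub>1 s) \<le> 3 * r / 1000" "(partner s - \<Gamma>\<^sub>1 s) \<bullet> \<tau> s = 0"
proof -
  obtain v where td: "tangent_dir s v" using ex_tangent_dir by blast
  note v = tangent_dirD[OF td]
  obtain y where y: "y \<in> range \<Gamma>\<^sub>2" "norm (y - \<Gamma>\<^sub>1 s) \<le> 3 * r / 1000" "(y - \<Gamma>\<^sub>1 s) \<bullet> \<tau> s = 0"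
    using curve2_nearly_straight_and_transversal(2)[OF td] by blast
  from partner_eqI[OF this] y
  show "partner s \<in> range \<Gamma>\<^sub>2" "norm (partner s - \<Gamma>\<^sub>1 s) \<le> 3 * r / 1000" "(partner s - \<Gamma>\<^sub>1 s) \<bullet> \<tau> s = 0"
    by simp_all
qed

lemma partner_cong: "\<Gamma>\<^sub>1 s = \<Gamma>\<^sub>1 t \<Longrightarrow> partner s = partner t"
  using \<tau>_eq[of s t] by (simp add: partner_def)

text \<open>Dual to the existence of partners: the point \<open>y\<close> stays fixed and the plane
  moves along the first curve.\<close>

lemma range_subset_partner: "range \<Gamma>\<^sub>2 \<subseteq> range partner"
proof
  fix y assume y: "y \<in> range \<Gamma>\<^sub>2"
  then obtain s where s: "norm (y - \<Gamma>\<^sub>1 s) \<le> r / 1000" using near21 by blast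
  obtain v where td: "tangent_dir s v" using ex_tangent_dir by blast
  note v = tangent_dirD[OF td]
  \<comment> \<open>The plane also turns as \<open>t\<close> moves, but over a step of
    \<open>2 * r / 1000\<close> the secant changes by at most 2/1000, so the sign change
    survives.\<close>
  define h where "h t = (y - \<Gamma>\<^sub>1 t) \<bullet> \<tau> t" for t
  have bound: "\<bar>(y - \<Gamma>\<^sub>1 s) \<bullet> \<tau> t\<bar> \<le> r / 1000" for t
  proof -
    have "\<bar>(y - \<Gamma>\<^sub>1 s) \<bullet> \<tau> t\<bar> \<le> norm (y - \<Gamma>\<^sub>1 s) * norm (\<tau> t)" by (rule Cauchy_Schwarz_ineq2)
    also have "\<dots> \<le> (r / 1000) * 1" using s norm_\<tau> r by (intro mult_mono) auto
    finally show ?thesis by simp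
  qed
  have incr: "r / 1000 \<le> (\<Gamma>\<^sub>1 b - \<Gamma>\<^sub>1 a) \<bullet> \<tau> t"
    if "s - r \<le> a" "a \<le> b" "b \<le> s + r" "b - a = 2 * r / 1000" "\<bar>t - s\<bar> \<le> 2 * r / 1000" for a b t
  proof -
    define k where "k = \<Gamma>\<^sub>1 b - \<Gamma>\<^sub>1 a"
    have k: "norm k \<le> 2 * r / 1000" using norm1[of b a] that by (simp add: k_def)
    have "norm (\<tau> t - \<tau> s) \<le> 2 / 1000"
      using order_trans[OF \<tau>_lipschitz[of t s] divide_right_mono[OF that(5)]] r by simp
    then have "norm (\<tau> t - v) \<le> 1/50"
      using norm_triangle_ineq[of "\<tau> t - \<tau> s" "\<tau> s - v"] v(4) by simp
    then have "k \<bullet> v - 1/50 * norm k \<le> k \<bullet> \<tau> t" by (rule inner_ge_perturb)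
    moreover have "199/200 * (2 * r / 1000) \<le> k \<bullet> v" using v(3)[of a b] that by (simp add: k_def)
    ultimately show ?thesis using k r unfolding k_def by linarith
  qed
  have "(1/r)-lipschitz_on UNIV \<tau>"
    using \<tau>_lipschitz r by (intro lipschitz_onI) (auto simp: dist_norm)
  then have "continuous_on T \<tau>" for T
    by (rule lipschitz_on_continuous_on[OF lipschitz_on_subset[OF _ subset_UNIV]])
  then have "continuous_on T h" for T
    unfolding h_def by (intro continuous_intros continuous1)
  moreover have "h (s + 2 * r / 1000) \<le> 0"
  proof -
    let ?b = "s + 2 * r / 1000"
    have "r / 1000 \<le> (\<Gamma>\<^sub>1 ?b - \<Gamma>\<^sub>1 s) \<bullet> \<tau> ?b" using r by (intro incr) auto
    then show ?thesis using bound[of ?b] unfolding h_def inner_diff_left by linarith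
  qed
  moreover have "0 \<le> h (s - 2 * r / 1000)"
  proof -
    let ?a = "s - 2 * r / 1000"
    have "r / 1000 \<le> (\<Gamma>\<^sub>1 s - \<Gamma>\<^sub>1 ?a) \<bullet> \<tau> ?a" using r by (intro incr) auto
    then show ?thesis using bound[of ?a] unfolding h_def inner_diff_left by linarith
  qed
  ultimately obtain t where t: "s - 2 * r / 1000 \<le> t" "t \<le> s + 2 * r / 1000" "h t = 0"
    using IVT2'[of h "s + 2 * r / 1000" 0 "s - 2 * r / 1000"] r by auto
  have "norm (y - \<Gamma>\<^sub>1 t) \<le> norm (y - \<Gamma>\<^sub>1 s) + norm (\<Gamma>\<^sub>1 s - \<Gamma>\<^sub>1 t)"
    using norm_triangle_ineq[of "y - \<Gamma>\<^sub>1 s" "\<Gamma>\<^sub>1 s - \<Gamma>\<^sub>1 t"] by simp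
  also have "norm (\<Gamma>\<^sub>1 s - \<Gamma>\<^sub>1 t) \<le> 2 * r / 1000" using norm1[of s t] t by linarith
  finally have "norm (y - \<Gamma>\<^sub>1 t) \<le> 3 * r / 1000" using s by simp
  then have "partner t = y" using y t(3) by (intro partner_eqI) (auto simp: h_def)
  then show "y \<in> range partner" by blast
qed

text \<open>The difference of two displacements is split along \<open>v\<close>. Its part along
  \<open>v\<close> is small by orthogonality to slowly turning secants, its transverse part by the
  cone conditions of both curves.\<close>

lemma displacement_lipschitz:
  "norm ((partner s - \<Gamma>\<^sub>1 s) - (partner t - \<Gamma>\<^sub>1 t)) \<le> 1/4 * norm (\<Gamma>\<^sub>1 s - \<Gamma>\<^sub>1 t)"
proof (cases "norm (\<Gamma>\<^sub>1 s - \<Gamma>\<^sub>1 t) \<le> r/4")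
  \<comment> \<open>Two displacements of size \<open>3 * r / 1000\<close> sum to less than a quarter
    of a distance exceeding \<open>r/4\<close>.\<close>
  case False
  then show ?thesis
    using norm_triangle_ineq4[of "partner s - \<Gamma>\<^sub>1 s" "partner t - \<Gamma>\<^sub>1 t"] partner(2)[of s] partner(2)[of t] r by linarith
next
  case True
  obtain v where td: "tangent_dir s v" using ex_tangent_dir by blast
  note v = tangent_dirD[OF td]
  note ns2 = curve2_nearly_straight_and_transversal(1)[OF td]
  have ball: "\<Gamma>\<^sub>1 x \<in> range \<Gamma>\<^sub>1 \<inter> cball (\<Gamma>\<^sub>1 s) r" if "s - r \<le> x" "x \<le> s + r" for x
    using norm1[of s x] that by (auto simp: dist_norm)
  have tball: "\<Gamma>\<^sub>1 t \<in> range \<Gamma>\<^sub>1 \<inter> cball (\<Gamma>\<^sub>1 s) r" using True r by (auto simp: dist_norm)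
  \<comment> \<open>Closeness in space becomes closeness in parameter: the arc around
    \<open>s\<close> has a point \<open>t'\<close> at the same height along \<open>v\<close> as the
    point at \<open>t\<close>, and the cone condition identifies the two points.\<close>
  have "\<bar>(\<Gamma>\<^sub>1 s - \<Gamma>\<^sub>1 t) \<bullet> v\<bar> \<le> r/4"
    using Cauchy_Schwarz_ineq2[of "\<Gamma>\<^sub>1 s - \<Gamma>\<^sub>1 t" v] True v(1) by simp
  moreover have "199/200 * r \<le> (\<Gamma>\<^sub>1 (s + r) - \<Gamma>\<^sub>1 s) \<bullet> v" "199/200 * r \<le> (\<Gamma>\<^sub>1 s - \<Gamma>\<^sub>1 (s - r)) \<bullet> v"
    using v(3)[of s "s + r"] v(3)[of "s - r" s] r by auto
  ultimately have "\<Gamma>\<^sub>1 (s - r) \<bullet> v \<le> \<Gamma>\<^sub>1 t \<bullet> v" "\<Gamma>\<^sub>1 t \<bullet> v \<le> \<Gamma>\<^sub>1 (s + r) \<bullet> v"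
    using r unfolding inner_diff_left by linarith+
  moreover have "continuous_on {s-r..s+r} (\<lambda>x. \<Gamma>\<^sub>1 x \<bullet> v)" by (intro continuous_intros continuous1)
  ultimately obtain t' where t': "s - r \<le> t'" "t' \<le> s + r" "\<Gamma>\<^sub>1 t' \<bullet> v = \<Gamma>\<^sub>1 t \<bullet> v"
    using IVT'[of "\<lambda>x. \<Gamma>\<^sub>1 x \<bullet> v" "s - r" "\<Gamma>\<^sub>1 t \<bullet> v" "s + r"] r by auto
  have "\<Gamma>\<^sub>1 t' = \<Gamma>\<^sub>1 t"
    using nearly_straight_norm_le[OF v(2,1) ball[OF t'(1,2)] tball] t'(3) by (simp add: inner_diff_left)
  then have partner_t: "partner t = partner t'" and \<tau>t: "\<tau> t = \<tau> t'" and \<Gamma>t: "\<Gamma>\<^sub>1 t = \<Gamma>\<^sub>1 t'"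
    using partner_cong[of t t'] \<tau>_eq[of t t'] by auto
  define D where "D = norm (\<Gamma>\<^sub>1 s - \<Gamma>\<^sub>1 t)"
  have st: "\<bar>s - t'\<bar> \<le> 2 * D"
  proof -
    have "199/200 * \<bar>s - t'\<bar> \<le> \<bar>(\<Gamma>\<^sub>1 s - \<Gamma>\<^sub>1 t') \<bullet> v\<bar>"
      using v(3)[of s t'] v(3)[of t' s] t' r by (cases "s \<le> t'") (auto simp: inner_diff_left)
    also have "\<dots> \<le> D" using Cauchy_Schwarz_ineq2[of "\<Gamma>\<^sub>1 s - \<Gamma>\<^sub>1 t'" v] v(1) by (simp add: D_def \<Gamma>t)
    finally have "199/200 * \<bar>s - t'\<bar> \<le> D" .
    moreover have "D \<ge> 0" by (simp add: D_def)
    moreover have "199/200 * a \<le> D \<Longrightarrow> D \<ge> 0 \<Longrightarrow> a \<le> 2 * D" for a by simp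
    ultimately show ?thesis by blast
  qed
  define w where "w = (partner s - \<Gamma>\<^sub>1 s) - (partner t - \<Gamma>\<^sub>1 t)"
  \<comment> \<open>Each displacement is orthogonal to its own secant, so only the change of the
    secant is left; the \<open>r\<close> of its Lipschitz constant cancels against the size of the
    displacement.\<close>
  have "w \<bullet> \<tau> s = (partner t - \<Gamma>\<^sub>1 t) \<bullet> (\<tau> t - \<tau> s)"
    using partner(3)[of s] partner(3)[of t] by (simp add: w_def inner_diff_left inner_diff_right)
  then have "\<bar>w \<bullet> \<tau> s\<bar> \<le> norm (partner t - \<Gamma>\<^sub>1 t) * norm (\<tau> t - \<tau> s)" by (simp add: Cauchy_Schwarz_ineq2)
  also have "\<dots> \<le> (3 * r / 1000) * (2 * D / r)"
  proof (rule mult_mono)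
    show "norm (\<tau> t - \<tau> s) \<le> 2 * D / r"
      using order_trans[OF \<tau>_lipschitz[of s t'] divide_right_mono[OF st]] r
      by (simp add: \<tau>t norm_minus_commute)
  qed (use partner(2) r in \<open>auto simp: D_def\<close>)
  also have "\<dots> = 6/1000 * D" using r by simp
  finally have w\<tau>: "\<bar>w \<bullet> \<tau> s\<bar> \<le> 6/1000 * D" .
  have "\<bar>w \<bullet> v\<bar> \<le> \<bar>w \<bullet> \<tau> s\<bar> + \<bar>w \<bullet> (\<tau> s - v)\<bar>" by (simp add: inner_diff_right)
  also have "\<bar>w \<bullet> (\<tau> s - v)\<bar> \<le> norm w * (1/100)"
    by (rule order_trans[OF Cauchy_Schwarz_ineq2]) (intro mult_left_mono v(4), simp)
  finally have wv: "\<bar>w \<bullet> v\<bar> \<le> 6/1000 * D + 1/100 * norm w" using w\<tau> by simp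
  define k l where "k = partner s - partner t" and "l = \<Gamma>\<^sub>1 s - \<Gamma>\<^sub>1 t"
  have "partner s \<in> range \<Gamma>\<^sub>2 \<inter> cball (\<Gamma>\<^sub>1 s) (r/2)"
    using partner[of s] r by (auto simp: dist_norm norm_minus_commute)
  moreover have "partner t \<in> range \<Gamma>\<^sub>2 \<inter> cball (\<Gamma>\<^sub>1 s) (r/2)"
    using partner[of t] True r norm_triangle_ineq4[of "\<Gamma>\<^sub>1 s - \<Gamma>\<^sub>1 t" "partner t - \<Gamma>\<^sub>1 t"] by (auto simp: dist_norm)
  ultimately have k: "norm (k - (k \<bullet> v) *\<^sub>R v) \<le> 1/10 * norm k"
    unfolding k_def by (rule nearly_straightD[OF ns2])
  have l: "norm (l - (l \<bullet> v) *\<^sub>R v) \<le> 1/200 * D"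
    unfolding l_def D_def using r by (intro nearly_straightD[OF v(2)] tball ball) auto
  have kn: "norm k \<le> norm w + D"
    using norm_triangle_ineq[of w l] by (simp add: w_def k_def l_def D_def)
  \<comment> \<open>The transverse part of \<open>w\<close> is at most a tenth of
    \<open>norm k\<close> plus 1/200 of \<open>D\<close>. As \<open>norm k \<le> norm w + D\<close>,
    the terms with \<open>norm w\<close> are absorbed on the left, leaving about an eighth of
    \<open>D\<close>.\<close>
  have "w - (w \<bullet> v) *\<^sub>R v = (k - (k \<bullet> v) *\<^sub>R v) - (l - (l \<bullet> v) *\<^sub>R v)"
    by (simp add: w_def k_def l_def algebra_simps)
  then have "norm (w - (w \<bullet> v) *\<^sub>R v) \<le> norm (k - (k \<bullet> v) *\<^sub>R v) + norm (l - (l \<bullet> v) *\<^sub>R v)"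
    by (metis norm_triangle_ineq4)
  moreover have "norm w \<le> norm (w - (w \<bullet> v) *\<^sub>R v) + \<bar>w \<bullet> v\<bar>"
    using norm_triangle_ineq[of "w - (w \<bullet> v) *\<^sub>R v" "(w \<bullet> v) *\<^sub>R v"] v(1) by simp
  ultimately have "norm w \<le> 1/4 * D"
    using k l kn wv norm_ge_zero[of w] norm_ge_zero[of l] unfolding D_def by linarith
  then show ?thesis by (simp add: w_def D_def)
qed

lemma ambient_isotopic:
  assumes "DIM('a) < 4"
  shows "ambient_isotopic (range \<Gamma>\<^sub>1) (range \<Gamma>\<^sub>2)"
proof -
  define S where "S x = (SOME s. \<Gamma>\<^sub>1 s = x)" for x
  have S: "\<Gamma>\<^sub>1 (S x) = x" if "x \<in> range \<Gamma>\<^sub>1" for x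
    unfolding S_def using that by (auto intro: someI)
  define f where "f x = partner (S x) - x" for x
  have f: "f (\<Gamma>\<^sub>1 s) = partner s - \<Gamma>\<^sub>1 s" for s
    using partner_cong[OF S[of "\<Gamma>\<^sub>1 s"]] by (simp add: f_def)
  have "(1/4)-lipschitz_on (range \<Gamma>\<^sub>1) f"
    using displacement_lipschitz by (intro lipschitz_onI) (auto simp: f dist_norm)
  then have "ambient_isotopic (range \<Gamma>\<^sub>1) ((\<lambda>x. x + f x) ` range \<Gamma>\<^sub>1)"
    using assms by (intro ambient_isotopic_small_lipschitz) auto
  also have "(\<lambda>x. x + f x) ` range \<Gamma>\<^sub>1 = range partner" by (simp add: image_image f)
  also have "range partner = range \<Gamma>\<^sub>2" using range_subset_partner partner(1) by blast
  finally show ?thesis .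
qed

end

section \<open>Isotopy of curves of finite energy\<close>

lemma flat_chords_imp_locally_straight:
  fixes \<Gamma> :: "real \<Rightarrow> 'a::euclidean_space"
  assumes inj: "injective_arclength_param L \<Gamma>" and L: "L > 0" and R: "R > 0" and \<eta>: "0 \<le> \<eta>" "\<eta> < 1/2"
    and flat: "\<And>x y z. x \<in> range \<Gamma> \<Longrightarrow> y \<in> range \<Gamma> \<Longrightarrow> z \<in> range \<Gamma> \<Longrightarrow> y \<noteq> x \<Longrightarrow> z \<noteq> x \<Longrightarrow>
      norm (y - x) \<le> R \<Longrightarrow> norm (z - x) \<le> R \<Longrightarrow> line_dev (y - x) (z - x) \<le> \<eta>"
  shows "locally_straight (2 * \<eta>) (R / 2) \<Gamma>"
  unfolding locally_straight_def
proof
  fix s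
  have arc: "arclength_param L \<Gamma>" using inj by (simp add: injective_arclength_param_def)
  \<comment> \<open>The reference chord: \<open>h < L\<close> makes it nonzero by injectivity,
    \<open>h \<le> R/2\<close> keeps it inside the ball.\<close>
  define h where "h = min (R/2) (L/2)"
  have h: "0 < h" "h \<le> R/2" "h < L" using R L by (auto simp: h_def)
  have "\<Gamma> (s + h) \<noteq> \<Gamma> s"
    using inj_onD[OF injective_arclength_param_inj_on[OF inj L, of s], of "s + h" s] h by auto
  moreover have "norm (\<Gamma> (s + h) - \<Gamma> s) \<le> R/2" using arclength_param_norm_le[OF arc, of "s + h" s] h by simp
  ultimately have "nearly_straight (2 * \<eta>) (sgn (\<Gamma> (s + h) - \<Gamma> s)) (range \<Gamma> \<inter> cball (\<Gamma> s) (R/2))"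
    and "norm (sgn (\<Gamma> (s + h) - \<Gamma> s)) = 1"
    using flat_chords_imp_nearly_straight[OF flat, where x = "\<Gamma> s" and w = "\<Gamma> (s + h)"]
    by (simp_all add: norm_sgn)
  then show "\<exists>v. norm v = 1 \<and> nearly_straight (2 * \<eta>) v (range \<Gamma> \<inter> cball (\<Gamma> s) (R/2)) \<and>
    (\<forall>t t'. s - R/2 \<le> t \<longrightarrow> t \<le> t' \<longrightarrow> t' \<le> s + R/2 \<longrightarrow> (1 - 2 * \<eta>) * (t' - t) \<le> (\<Gamma> t' - \<Gamma> t) \<bullet> v)"
    using R \<eta> by (intro nearly_straight_imp_monotone_arc[OF inj L]) auto
qed

lemma hausdorff_distance_lessD:
  assumes "bounded A" "bounded B" "A \<noteq> {}" "B \<noteq> {}" "hausdorff_distance A B < d"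
  shows "x \<in> A \<Longrightarrow> \<exists>y\<in>B. dist x y < d" and "y \<in> B \<Longrightarrow> \<exists>x\<in>A. dist y x < d"
proof -
  \<comment> \<open>A supremum in the reals bounds its set only if the set is bounded above;
    boundedness of both images enters here.\<close>
  have bdd: "bdd_above ((\<lambda>x. infdist x T) ` S)" if "bounded S" "T \<noteq> {}" for S T :: "'a set"
  proof -
    from \<open>T \<noteq> {}\<close> obtain t where t: "t \<in> T" by auto
    from \<open>bounded S\<close> obtain e where e: "\<And>x. x \<in> S \<Longrightarrow> dist t x \<le> e"
      using bounded_any_center[of S t] by auto
    have "infdist x T \<le> e" if "x \<in> S" for x
      using infdist_le[OF t, of x] e[OF that] by (simp add: dist_commute)
    then show ?thesis by (rule bdd_aboveI2)
  qed
  show "\<exists>y\<in>B. dist x y < d" if "x \<in> A"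
  proof (rule infdist_lessD[OF _ assms(4)])
    show "infdist x B < d"
      using cSUP_upper[OF that bdd[OF assms(1,4)]] assms(5) by (simp add: hausdorff_distance_def)
  qed
  show "\<exists>x\<in>A. dist y x < d" if "y \<in> B"
  proof (rule infdist_lessD[OF _ assms(3)])
    show "infdist y A < d"
      using cSUP_upper[OF that bdd[OF assms(2,3)]] assms(5) by (simp add: hausdorff_distance_def)
  qed
qed

lemma arclength_param_bounded_range:
  fixes \<Gamma> :: "real \<Rightarrow> 'a::euclidean_space"
  assumes "arclength_param L \<Gamma>" "L > 0"
  shows "bounded (range \<Gamma>)"
proof -
  have "dist (\<Gamma> 0) (\<Gamma> t) \<le> L" for t
  proof -
    obtain k where k: "t + of_int k * L \<in> {0..<0+L}" "\<Gamma> (t + of_int k * L) = \<Gamma> t"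
      by (rule arclength_param_reduce[OF assms])
    then show ?thesis using arclength_param_norm_le[OF assms(1), of 0 "t + of_int k * L"] by (simp add: dist_norm)
  qed
  then show ?thesis unfolding bounded_def by blast
qed

theorem theorem1p2:
  fixes q :: real
  assumes "q > 2"
  shows "\<exists>\<delta>>0. \<forall>(L\<^sub>1::real) (L\<^sub>2::real) (\<Gamma>\<^sub>1 :: real \<Rightarrow> real ^ 3) (\<Gamma>\<^sub>2 :: real \<Rightarrow> real ^ 3).
    L\<^sub>1 > 0 \<longrightarrow> L\<^sub>2 > 0 \<longrightarrow>
    injective_arclength_param L\<^sub>1 \<Gamma>\<^sub>1 \<longrightarrow> injective_arclength_param L\<^sub>2 \<Gamma>\<^sub>2 \<longrightarrow>
    tangent_point_energy q L\<^sub>1 \<Gamma>\<^sub>1 < \<infinity> \<longrightarrow> tangent_point_energy q L\<^sub>2 \<Gamma>\<^sub>2 < \<infinity> \<longrightarrow>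
    hausdorff_distance (range \<Gamma>\<^sub>1) (range \<Gamma>\<^sub>2) <
      \<delta> * enn2real (max (tangent_point_energy q L\<^sub>1 \<Gamma>\<^sub>1) (tangent_point_energy q L\<^sub>2 \<Gamma>\<^sub>2))
            powr (- (1 / (q - 2))) \<longrightarrow>
    ambient_isotopic (range \<Gamma>\<^sub>1) (range \<Gamma>\<^sub>2)"
proof -
  \<comment> \<open>Half of the 1/200 in \<open>close_curves\<close>, since passing from chords with
    a common endpoint to a cone doubles it.\<close>
  have "(0::real) < 1/400" by simp
  from tangent_point_energy_imp_flat_chords[OF assms this, where ?'a = "real ^ 3"]
  obtain c where c: "c > 0" and "\<forall>L (\<Gamma> :: real \<Rightarrow> real ^ 3) E x y z.
    L > 0 \<longrightarrow> arclength_param L \<Gamma> \<longrightarrow> E > 0 \<longrightarrow> tangent_point_energy q L \<Gamma> \<le> ennreal E \<longrightarrow>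
    x \<in> range \<Gamma> \<longrightarrow> y \<in> range \<Gamma> \<longrightarrow> z \<in> range \<Gamma> \<longrightarrow> y \<noteq> x \<longrightarrow> z \<noteq> x \<longrightarrow>
    norm (y - x) \<le> c * E powr (- (1 / (q - 2))) \<longrightarrow> norm (z - x) \<le> c * E powr (- (1 / (q - 2))) \<longrightarrow>
    line_dev (y - x) (z - x) \<le> 1/400"
    by (elim exE conjE)
  note flat = this(2)[rule_format]
  show ?thesis
  \<comment> \<open>Straightness holds at scale \<open>R / 2\<close>, and
    \<open>close_curves\<close> asks for a thousandth of that scale.\<close>
  proof (intro exI[of _ "c / 2000"] conjI allI impI)
    show "c / 2000 > 0" using c by simp
  next
    fix L\<^sub>1 L\<^sub>2 :: real and \<Gamma>\<^sub>1 \<Gamma>\<^sub>2 :: "real \<Rightarrow> real ^ 3"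
    assume L: "L\<^sub>1 > 0" "L\<^sub>2 > 0"
      and inj: "injective_arclength_param L\<^sub>1 \<Gamma>\<^sub>1" "injective_arclength_param L\<^sub>2 \<Gamma>\<^sub>2"
      and fin: "tangent_point_energy q L\<^sub>1 \<Gamma>\<^sub>1 < \<infinity>" "tangent_point_energy q L\<^sub>2 \<Gamma>\<^sub>2 < \<infinity>"
    define E where "E = enn2real (max (tangent_point_energy q L\<^sub>1 \<Gamma>\<^sub>1) (tangent_point_energy q L\<^sub>2 \<Gamma>\<^sub>2))"
    define R where "R = c * E powr (- (1 / (q - 2)))"
    assume "hausdorff_distance (range \<Gamma>\<^sub>1) (range \<Gamma>\<^sub>2) <
      c / 2000 * enn2real (max (tangent_point_energy q L\<^sub>1 \<Gamma>\<^sub>1) (tangent_point_energy q L\<^sub>2 \<Gamma>\<^sub>2))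
            powr (- (1 / (q - 2)))"
    then have hd: "hausdorff_distance (range \<Gamma>\<^sub>1) (range \<Gamma>\<^sub>2) < R / 2 / 1000"
      by (simp add: R_def E_def)
    have arc: "arclength_param L\<^sub>1 \<Gamma>\<^sub>1" "arclength_param L\<^sub>2 \<Gamma>\<^sub>2"
      using inj by (auto simp: injective_arclength_param_def)
    note near = hausdorff_distance_lessD[OF arclength_param_bounded_range[OF arc(1) L(1)]
        arclength_param_bounded_range[OF arc(2) L(2)] _ _ hd, simplified]
    have "0 < R"
    proof -
      obtain u where "dist (\<Gamma>\<^sub>1 0) (\<Gamma>\<^sub>2 u) * 2000 < R" using near(1)[of "\<Gamma>\<^sub>1 0"] by auto
      then show ?thesis using zero_le_dist[of "\<Gamma>\<^sub>1 0" "\<Gamma>\<^sub>2 u"] by linarith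
    qed
    \<comment> \<open>As \<open>0 powr x = 0\<close>, a vanishing \<open>E\<close> would give
      \<open>R = 0\<close>, and no Hausdorff distance is below that.\<close>
    then have E: "E > 0" by (cases "E = 0") (auto simp: R_def E_def less_le)
    have "ennreal E = max (tangent_point_energy q L\<^sub>1 \<Gamma>\<^sub>1) (tangent_point_energy q L\<^sub>2 \<Gamma>\<^sub>2)"
      using fin by (simp add: E_def max_def)
    then have le: "tangent_point_energy q L\<^sub>1 \<Gamma>\<^sub>1 \<le> ennreal E" "tangent_point_energy q L\<^sub>2 \<Gamma>\<^sub>2 \<le> ennreal E"
      by simp_all
    have straight: "locally_straight (2 * (1/400)) (R/2) \<Gamma>\<^sub>1" "locally_straight (2 * (1/400)) (R/2) \<Gamma>\<^sub>2"
      using flat[OF L(1) arc(1) E le(1)] flat[OF L(2) arc(2) E le(2)] \<open>0 < R\<close>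
      by (intro flat_chords_imp_locally_straight[OF inj(1) L(1)]
          flat_chords_imp_locally_straight[OF inj(2) L(2)]; simp add: R_def)+
    interpret close_curves L\<^sub>1 L\<^sub>2 "R/2" \<Gamma>\<^sub>1 \<Gamma>\<^sub>2
    proof
      show "\<exists>u. norm (\<Gamma>\<^sub>2 u - \<Gamma>\<^sub>1 s) \<le> R / 2 / 1000" for s
        using near(1)[of "\<Gamma>\<^sub>1 s"] by (auto simp: dist_norm norm_minus_commute intro: less_imp_le)
      show "\<exists>s. norm (\<Gamma>\<^sub>2 u - \<Gamma>\<^sub>1 s) \<le> R / 2 / 1000" for u
        using near(2)[of "\<Gamma>\<^sub>2 u"] by (auto simp: dist_norm intro: less_imp_le)
    qed (use L inj arc straight \<open>0 < R\<close> in simp_all)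
    show "ambient_isotopic (range \<Gamma>\<^sub>1) (range \<Gamma>\<^sub>2)" by (rule ambient_isotopic) simp
  qed
qed

end
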